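(* Let $f:\mathbb{R}\to\mathbb{R}$ be a computable function. The following are equivalent: (1) $f$ has Luzin's (N); (2) for every $\mathcal{O}$-computable compact set $A\subseteq\mathbb{R}$ with $\lambda(A)=0$, also $\lambda(f(A))=0$; (3) $f$ reflects $\mathcal{O}$-Kurtz randomness.
   Context: $\lambda$ is Lebesgue measure. Luzin's (N): the image of every Lebesgue null set is null. $\mathcal{O}$ is Kleene's $\mathcal{O}$. For an oracle $Z$, a $Z$-computable compact set is a compact $A\subseteq\mathbb{R}$ that is effectively closed relative to $Z$ and bounded, i.e. a bounded $\Pi^0_1(Z)$ set (its complement is the union of a $Z$-computably enumerable sequence of rational open intervals). A real is $Z$-Kurtz random if it belongs to no $Z$-computable compact set of Lebesgue measure $0$. $f$ reflects $Z$-Kurtz randomness if for all $x$, $f(x)$ $Z$-Kurtz random implies $x$ $Z$-Kurtz random. *)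

theory Defs
  imports "HOL-Analysis.Analysis"
begin

section \<open>Oracle computability\<close>

text \<open>Partial recursive functions relative to an oracle \<open>g :: nat \<Rightarrow> nat\<close>: Kleene's schemes plus
  an instruction that queries the oracle. A program applied to too few arguments is undefined;
  superfluous arguments are ignored.\<close>

datatype prog =
    Zero
  | Succ
  | Proj nat
  | Query
  | Comp prog "prog list"
  | Prec prog prog
  | Mini prog

fun run :: "(nat \<Rightarrow> nat) \<Rightarrow> prog \<Rightarrow> nat list \<Rightarrow> nat option" where
  "run g Zero xs = Some 0"
| "run g Succ xs = (case xs of [] \<Rightarrow> None | x # _ \<Rightarrow> Some (Suc x))"
| "run g (Proj i) xs = (if i < length xs then Some (xs ! i) else None)"
| "run g Query xs = (case xs of [] \<Rightarrow> None | x # _ \<Rightarrow> Some (g x))"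
| "run g (Comp p qs) xs = Option.bind (those (map (\<lambda>q. run g q xs) qs)) (\<lambda>ys. run g p ys)"
| "run g (Prec p q) xs = (case xs of [] \<Rightarrow> None
     | n # ys \<Rightarrow> rec_nat (run g p ys) (\<lambda>k r. Option.bind r (\<lambda>y. run g q (k # y # ys))) n)"
| "run g (Mini p) xs =
     (if \<exists>n. run g p (n # xs) = Some 0 \<and> (\<forall>m<n. run g p (m # xs) \<noteq> None)
      then Some (LEAST n. run g p (n # xs) = Some 0)
      else None)"

text \<open>Numbering of programs, for Kleene's \<open>\<O>\<close>.\<close>

fun prog_code :: "prog \<Rightarrow> nat" where
  "prog_code Zero = prod_encode (0, 0)"
| "prog_code Succ = prod_encode (1, 0)"
| "prog_code (Proj i) = prod_encode (2, i)"
| "prog_code Query = prod_encode (3, 0)"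
| "prog_code (Comp p qs) =
     prod_encode (4, prod_encode (prog_code p, list_encode (map prog_code qs)))"
| "prog_code (Prec p q) = prod_encode (5, prod_encode (prog_code p, prog_code q))"
| "prog_code (Mini p) = prod_encode (6, prog_code p)"

lemma prog_code_eq: "prog_code p = prog_code q \<Longrightarrow> p = q"
proof (induction p arbitrary: q)
  case Zero
  then show ?case by (cases q) simp_all
next
  case Succ
  then show ?case by (cases q) simp_all
next
  case (Proj i)
  then show ?case by (cases q) simp_all
next
  case Query
  then show ?case by (cases q) simp_all
next
  case (Comp p ps)
  then obtain p' ps' where q: "q = Comp p' ps'"
    by (cases q) simp_all
  with Comp.prems have p: "prog_code p = prog_code p'" and m: "map prog_code ps = map prog_code ps'"
    by (simp_all add: list_encode_eq)
  have "ps = ps'"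
    using m Comp.IH(2) by (intro list.inj_map_strong[OF _ m])
  with p show ?case
    using Comp.IH(1) q by simp
next
  case (Prec p1 p2)
  then show ?case by (cases q) simp_all
next
  case (Mini p)
  then show ?case by (cases q) simp_all
qed

lemma inj_prog_code: "inj prog_code"
  by (rule injI) (rule prog_code_eq)

text \<open>\<open>phi e\<close> is the \<open>e\<close>-th unary partial computable function (no oracle, i.e. the constant-zero
  one); it is nowhere defined if \<open>e\<close> codes no program.\<close>

definition phi :: "nat \<Rightarrow> nat \<Rightarrow> nat option" where
  "phi e n = (if e \<in> range prog_code then run (\<lambda>_. 0) (inv prog_code e) [n] else None)"

definition computable_in :: "nat set \<Rightarrow> (nat \<Rightarrow> nat) \<Rightarrow> bool" where
  "computable_in Z h \<longleftrightarrow> (\<exists>p. \<forall>n. run (\<lambda>k. of_bool (k \<in> Z)) p [n] = Some (h n))"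


section \<open>Kleene's \<open>\<O>\<close>\<close>

inductive in_O :: "nat \<Rightarrow> bool" and less_O :: "nat \<Rightarrow> nat \<Rightarrow> bool" where
  O_zero: "in_O 1"
| O_suc: "in_O a \<Longrightarrow> in_O (2 ^ a)"
| O_lim: "(\<And>n. phi e n = Some (h n)) \<Longrightarrow> (\<And>n. in_O (h n)) \<Longrightarrow> (\<And>n. less_O (h n) (h (Suc n)))
     \<Longrightarrow> in_O (3 * 5 ^ e)"
| less_O_suc: "in_O a \<Longrightarrow> less_O a (2 ^ a)"
| less_O_suc_trans: "in_O a \<Longrightarrow> less_O b a \<Longrightarrow> less_O b (2 ^ a)"
| less_O_lim: "in_O (3 * 5 ^ e) \<Longrightarrow> phi e n = Some a \<Longrightarrow> less_O b a \<Longrightarrow> less_O b (3 * 5 ^ e)"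

definition Kleene_O :: "nat set" where
  "Kleene_O = {a. in_O a}"


section \<open>Computability on the real line\<close>

definition cauchy_name :: "(nat \<Rightarrow> nat) \<Rightarrow> real \<Rightarrow> bool" where
  "cauchy_name g x \<longleftrightarrow> (\<forall>n. \<bar>real_of_rat (nat_to_rat_surj (g n)) - x\<bar> \<le> (1 / 2) ^ n)"

text \<open>One program transforms every fast Cauchy name of \<open>x\<close>, given as oracle, into some fast Cauchy
  name of \<open>f x\<close>, which may depend on the given name.\<close>

definition computable_real_fun :: "(real \<Rightarrow> real) \<Rightarrow> bool" where
  "computable_real_fun f \<longleftrightarrow>
     (\<exists>p. \<forall>x g. cauchy_name g x \<longrightarrow>
        (\<exists>h. cauchy_name h (f x) \<and> (\<forall>n. run g p [n] = Some (h n))))"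

text \<open>Every rational open interval has a code; the interval is empty if the endpoints are not in
  increasing order.\<close>

definition rat_interval :: "nat \<Rightarrow> real set" where
  "rat_interval k = (case prod_decode k of (i, j) \<Rightarrow>
     {real_of_rat (nat_to_rat_surj i) <..< real_of_rat (nat_to_rat_surj j)})"

definition effectively_closed :: "nat set \<Rightarrow> real set \<Rightarrow> bool" where
  "effectively_closed Z A \<longleftrightarrow> (\<exists>h. computable_in Z h \<and> - A = (\<Union>n. rat_interval (h n)))"

definition computable_compact :: "nat set \<Rightarrow> real set \<Rightarrow> bool" where
  "computable_compact Z A \<longleftrightarrow> effectively_closed Z A \<and> bounded A"

lemma computable_compact_imp_compact:
  assumes "computable_compact Z A"
  shows "compact A"
proof -
  obtain h :: "nat \<Rightarrow> nat" where "- A = (\<Union>n. rat_interval (h n))"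
    using assms unfolding computable_compact_def effectively_closed_def by blast
  then have "open (- A)"
    by (auto simp: rat_interval_def split: prod.split)
  with assms show ?thesis
    by (simp add: compact_eq_bounded_closed computable_compact_def closed_def)
qed


section \<open>Kurtz randomness and Luzin's property\<close>

definition Kurtz_random :: "nat set \<Rightarrow> real \<Rightarrow> bool" where
  "Kurtz_random Z x \<longleftrightarrow>
     \<not> (\<exists>A. computable_compact Z A \<and> A \<in> null_sets lebesgue \<and> x \<in> A)"

definition reflects_Kurtz_randomness :: "nat set \<Rightarrow> (real \<Rightarrow> real) \<Rightarrow> bool" where
  "reflects_Kurtz_randomness Z f \<longleftrightarrow> (\<forall>x. Kurtz_random Z (f x) \<longrightarrow> Kurtz_random Z x)"

definition Luzin_N :: "(real \<Rightarrow> real) \<Rightarrow> bool" where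
  "Luzin_N f \<longleftrightarrow> (\<forall>N. N \<in> null_sets lebesgue \<longrightarrow> f ` N \<in> null_sets lebesgue)"

end

theory Submission
  imports Defs
begin

text \<open>If \<open>f\<close> fails Luzin's property, then it maps some null set to a set of outer measure greater than some
  \<open>\<epsilon> = 2\<^sup>-\<^sup>e\<close>. By continuity of the outer measure along increasing unions one finds finite lists
  \<open>L\<^sub>0, L\<^sub>1, \<dots>\<close> of rational intervals, the \<open>j\<close>-th of total length at most \<open>2\<^sup>-\<^sup>j\<close>, such that for every
  \<open>n\<close> and every finite list \<open>u\<close> of total length at most \<open>\<epsilon>\<close>, some rational point in the first \<open>n\<close>
  lists has its image outside \<open>u\<close>. The sequences \<open>L\<close> with witnessing points form a \<open>\<Pi>\<^sup>0\<^sub>1\<close> class in Baire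
  space, so by Kleene's basis theorem there is one computable in \<open>\<O>\<close>. The intersection of the closed
  sets coded by it is an \<open>\<O>\<close>-computable compact null set, and by compactness its image is not
  covered by any such \<open>u\<close>, hence is not null.

  For the randomness formulation: the image of an \<open>\<O>\<close>-computable compact set is again one, because
  disjointness of the image of an open set from an open interval is a \<open>\<Pi>\<^sup>0\<^sub>1\<close> property, which \<open>\<O>\<close>
  decides. Conversely the reals that are not Kurtz random form a null set, as there are only
  countably many \<open>\<O>\<close>-computable compact sets.\<close>

section \<open>Closure properties of the recursive functions\<close>

text \<open>\<open>G = UNIV\<close> expresses computability without an oracle, a singleton expresses
  computability relative to one. One program serves all oracles in \<open>G\<close>, so results of
  the first kind transfer to the second.\<close>

definition recursive_on :: "(nat \<Rightarrow> nat) set \<Rightarrow> (nat \<Rightarrow> nat) \<Rightarrow> bool" where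
  "recursive_on G F \<longleftrightarrow> (\<exists>p. \<forall>g\<in>G. \<forall>x. run g p [x] = Some (F x))"

abbreviation decidable_on :: "(nat \<Rightarrow> nat) set \<Rightarrow> (nat \<Rightarrow> bool) \<Rightarrow> bool" where
  "decidable_on G P \<equiv> recursive_on G (\<lambda>x. of_bool (P x))"

definition fst_of :: "nat \<Rightarrow> nat" where "fst_of z = fst (prod_decode z)"
definition snd_of :: "nat \<Rightarrow> nat" where "snd_of z = snd (prod_decode z)"

lemma fst_of_pair [simp]: "fst_of (prod_encode (a, b)) = a"
  and snd_of_pair [simp]: "snd_of (prod_encode (a, b)) = b"
  by (simp_all add: fst_of_def snd_of_def)

lemma pair_fst_snd [simp]: "prod_encode (fst_of z, snd_of z) = z"
  by (simp add: fst_of_def snd_of_def)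

lemma fst_of_le: "fst_of z \<le> z"
  using le_prod_encode_1[of "fst_of z" "snd_of z"] by simp

section \<open>Programs for arithmetic and pairing\<close>

primrec const_prog :: "nat \<Rightarrow> prog" where
  "const_prog 0 = Zero"
| "const_prog (Suc n) = Comp Succ [const_prog n]"

lemma run_const_prog [simp]: "run g (const_prog n) xs = Some n"
  by (induction n) auto

definition add_prog :: prog where "add_prog = Prec (Proj 0) (Comp Succ [Proj 1])"
definition pred_prog :: prog where "pred_prog = Prec Zero (Proj 0)"
definition monus_prog :: prog where "monus_prog = Prec (Proj 0) (Comp pred_prog [Proj 1])"
definition mult_prog :: prog where "mult_prog = Prec Zero (Comp add_prog [Proj 1, Proj 2])"
definition triangle_prog :: prog where
  "triangle_prog = Prec Zero (Comp add_prog [Comp Succ [Proj 0], Proj 1])"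
definition pair_prog :: prog where
  "pair_prog = Comp add_prog [Comp triangle_prog [add_prog], Proj 0]"

lemma run_add_prog [simp]: "run g add_prog [x, y] = Some (x + y)"
  by (induction x) (auto simp: add_prog_def)

lemma run_pred_prog [simp]: "run g pred_prog [x] = Some (x - 1)"
  by (induction x) (auto simp: pred_prog_def)

lemma run_monus_prog [simp]: "run g monus_prog [x, y] = Some (y - x)"
proof (induction x)
  case (Suc x)
  then show ?case
    by (simp add: monus_prog_def)
qed (auto simp: monus_prog_def)

lemma run_mult_prog [simp]: "run g mult_prog [x, y] = Some (x * y)"
  by (induction x) (auto simp: mult_prog_def)

lemma run_triangle_prog [simp]: "run g triangle_prog [x] = Some (triangle x)"
  by (induction x) (auto simp: triangle_prog_def)

lemma run_pair_prog [simp]: "run g pair_prog [x, y] = Some (prod_encode (x, y))"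
  by (simp add: pair_prog_def prod_encode_def)

text \<open>Inverts the triangular numbers: the accumulator \<open>s\<close> rises by one exactly
  when the argument reaches \<open>triangle (Suc s)\<close>, which the truncated difference
  \<open>1 - (triangle (Suc s) - Suc z)\<close> detects.\<close>

definition diag_prog :: prog where
  "diag_prog = Prec Zero (Comp add_prog [Proj 1, Comp monus_prog
     [Comp monus_prog [Comp Succ [Proj 0], Comp triangle_prog [Comp Succ [Proj 1]]], const_prog 1]])"

lemma triangle_less_mono: "m < n \<Longrightarrow> triangle m < triangle n"
  by (rule lift_Suc_mono_less[of triangle]) auto

text \<open>A pair \<open>(a, b)\<close> is coded as \<open>triangle (a + b) + a\<close>. As
  \<open>triangle\<close> is strictly increasing, only \<open>s = a + b\<close> satisfies the two
  bounds kept by the recursion.\<close>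

lemma run_diag_prog: "run g diag_prog [z] = Some (fst_of z + snd_of z)"
proof -
  have "\<exists>s. run g diag_prog [z] = Some s \<and> triangle s \<le> z \<and> z < triangle (Suc s)"
  proof (induction z)
    case 0
    then show ?case by (simp add: diag_prog_def)
  next
    case (Suc z)
    then obtain s where s: "run g diag_prog [z] = Some s" "triangle s \<le> z" "z < triangle (Suc s)"
      by auto
    then have "run g diag_prog [Suc z] = Some (s + (1 - (triangle (Suc s) - Suc z)))"
      by (simp add: diag_prog_def)
    then show ?case
      using s(2,3) by (cases "triangle (Suc s) \<le> Suc z") auto
  qed
  then obtain s where s: "run g diag_prog [z] = Some s" "triangle s \<le> z" "z < triangle (Suc s)"
    by auto
  define t where "t = fst_of z + snd_of z"
  have "z = triangle t + fst_of z"
    using pair_fst_snd[of z] unfolding prod_encode_def t_def by simp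
  then have t: "triangle t \<le> z" "z < triangle (Suc t)"
    by (simp_all add: t_def)
  have "\<not> s < t"
    using triangle_less_mono[of "Suc s" t] s(3) t(1) by (cases "Suc s = t") auto
  moreover have "\<not> t < s"
    using triangle_less_mono[of "Suc t" s] t(2) s(2) by (cases "Suc t = s") auto
  ultimately show ?thesis
    using s(1) by (simp add: t_def)
qed

section \<open>Closure under composition, recursion, logic and search\<close>

lemma recursive_on_subset: "recursive_on G F \<Longrightarrow> G' \<subseteq> G \<Longrightarrow> recursive_on G' F"
  unfolding recursive_on_def by blast

lemma recursive_on_UNIV: "recursive_on UNIV F \<Longrightarrow> recursive_on G F"
  by (rule recursive_on_subset) auto

lemma recursive_comp:
  assumes "recursive_on G F" and "recursive_on G A"
  shows "recursive_on G (\<lambda>x. F (A x))"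
proof -
  obtain p q where "\<forall>g\<in>G. \<forall>x. run g p [x] = Some (F x)" "\<forall>g\<in>G. \<forall>x. run g q [x] = Some (A x)"
    using assms unfolding recursive_on_def by blast
  then have "\<forall>g\<in>G. \<forall>x. run g (Comp p [q]) [x] = Some (F (A x))"
    by simp
  then show ?thesis unfolding recursive_on_def by blast
qed

lemma recursive_binary_prog:
  assumes "\<And>g x y. run g p [x, y] = Some (F x y)" and "recursive_on G A" and "recursive_on G B"
  shows "recursive_on G (\<lambda>x. F (A x) (B x))"
proof -
  obtain q r where "\<forall>g\<in>G. \<forall>x. run g q [x] = Some (A x)" "\<forall>g\<in>G. \<forall>x. run g r [x] = Some (B x)"
    using assms unfolding recursive_on_def by blast
  then have "\<forall>g\<in>G. \<forall>x. run g (Comp p [q, r]) [x] = Some (F (A x) (B x))"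
    using assms(1) by simp
  then show ?thesis unfolding recursive_on_def by blast
qed

named_theorems recursive_intros

lemma recursive_id [recursive_intros]: "recursive_on G (\<lambda>x. x)"
  unfolding recursive_on_def by (rule exI[of _ "Proj 0"]) simp

lemma recursive_const [recursive_intros]: "recursive_on G (\<lambda>x. c)"
  unfolding recursive_on_def by (rule exI[of _ "const_prog c"]) simp

lemma recursive_add [recursive_intros]:
  "recursive_on G A \<Longrightarrow> recursive_on G B \<Longrightarrow> recursive_on G (\<lambda>x. A x + B x)"
  by (rule recursive_binary_prog[OF run_add_prog])

lemma recursive_mult [recursive_intros]:
  "recursive_on G A \<Longrightarrow> recursive_on G B \<Longrightarrow> recursive_on G (\<lambda>x. A x * B x)"
  by (rule recursive_binary_prog[OF run_mult_prog])

lemma recursive_diff [recursive_intros]: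
  "recursive_on G A \<Longrightarrow> recursive_on G B \<Longrightarrow> recursive_on G (\<lambda>x. A x - B x)"
  by (rule recursive_binary_prog[OF run_monus_prog])

lemma recursive_pair [recursive_intros]:
  "recursive_on G A \<Longrightarrow> recursive_on G B \<Longrightarrow> recursive_on G (\<lambda>x. prod_encode (A x, B x))"
  by (rule recursive_binary_prog[OF run_pair_prog])

lemma recursive_Suc [recursive_intros]: "recursive_on G A \<Longrightarrow> recursive_on G (\<lambda>x. Suc (A x))"
  using recursive_add[OF _ recursive_const[of G 1], of A] by simp

lemma recursive_fst_of [recursive_intros]:
  assumes "recursive_on G A" shows "recursive_on G (\<lambda>x. fst_of (A x))"
proof -
  have eq: "fst_of z = z - triangle (fst_of z + snd_of z)" for z
    using pair_fst_snd[of z] unfolding prod_encode_def by simp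
  have "recursive_on G (\<lambda>z. z - triangle (fst_of z + snd_of z))"
    unfolding recursive_on_def
    by (rule exI[of _ "Comp monus_prog [Comp triangle_prog [diag_prog], Proj 0]"])
      (simp add: run_diag_prog)
  then have "recursive_on G fst_of"
    unfolding eq[symmetric] .
  then show ?thesis using assms by (rule recursive_comp)
qed

lemma recursive_snd_of [recursive_intros]:
  assumes "recursive_on G A" shows "recursive_on G (\<lambda>x. snd_of (A x))"
proof -
  have "recursive_on G (\<lambda>z. fst_of z + snd_of z)"
    unfolding recursive_on_def by (rule exI[of _ diag_prog]) (simp add: run_diag_prog)
  from recursive_diff[OF this recursive_fst_of[OF recursive_id]]
  have "recursive_on G snd_of" by simp
  then show ?thesis using assms by (rule recursive_comp)
qed

lemma recursive_binary:
  assumes "recursive_on G (\<lambda>z. F (fst_of z) (snd_of z))" and "recursive_on G A" and "recursive_on G B"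
  shows "recursive_on G (\<lambda>x. F (A x) (B x))"
  using recursive_comp[OF assms(1) recursive_pair[OF assms(2,3)]] by simp

lemma recursive_rec_nat [recursive_intros]:
  assumes A: "recursive_on G A"
    and B: "recursive_on G (\<lambda>z. B (fst_of z) (fst_of (snd_of z)) (snd_of (snd_of z)))"
    and N: "recursive_on G N"
  shows "recursive_on G (\<lambda>x. rec_nat (A x) (\<lambda>i r. B i r x) (N x))"
proof -
  obtain pa where pa: "\<forall>g\<in>G. \<forall>x. run g pa [x] = Some (A x)"
    using A unfolding recursive_on_def by blast
  obtain pb where pb: "\<forall>g\<in>G. \<forall>z. run g pb [z] =
      Some (B (fst_of z) (fst_of (snd_of z)) (snd_of (snd_of z)))"
    using B unfolding recursive_on_def by blast
  obtain pn where pn: "\<forall>g\<in>G. \<forall>x. run g pn [x] = Some (N x)"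
    using N unfolding recursive_on_def by blast
  \<comment> \<open>\<open>Prec\<close> passes index, previous value and parameter separately,
    whereas \<open>pb\<close> is unary; the nested pairs repack them.\<close>
  define q where "q = Prec pa (Comp pb [Comp pair_prog [Proj 0, Comp pair_prog [Proj 1, Proj 2]]])"
  have "run g q [n, x] = Some (rec_nat (A x) (\<lambda>i r. B i r x) n)" if "g \<in> G" for g n x
    using that pa pb by (induction n) (auto simp: q_def)
  then have "\<forall>g\<in>G. \<forall>x. run g (Comp q [pn, Proj 0]) [x] = Some (rec_nat (A x) (\<lambda>i r. B i r x) (N x))"
    using pn by simp
  then show ?thesis
    unfolding recursive_on_def by blast
qed

lemma recursive_of_bool_not [recursive_intros]:
  assumes "decidable_on G P" shows "decidable_on G (\<lambda>x. \<not> P x)"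
proof -
  have eq: "(of_bool (\<not> P x) :: nat) = 1 - of_bool (P x)" for x by simp
  show ?thesis
    unfolding eq by (intro recursive_intros assms)
qed

lemma recursive_of_bool_le [recursive_intros]:
  assumes "recursive_on G A" and "recursive_on G B"
  shows "decidable_on G (\<lambda>x. A x \<le> B x)"
proof -
  have eq: "(of_bool (A x \<le> B x) :: nat) = 1 - (A x - B x)" for x by auto
  show ?thesis
    unfolding eq by (intro recursive_intros assms)
qed

lemma recursive_of_bool_less [recursive_intros]:
  assumes "recursive_on G A" and "recursive_on G B"
  shows "decidable_on G (\<lambda>x. A x < B x)"
  using recursive_of_bool_not[OF recursive_of_bool_le[OF assms(2,1)]] by (simp add: not_le)

lemma recursive_of_bool_conj [recursive_intros]:
  assumes "decidable_on G P" and "decidable_on G Q"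
  shows "decidable_on G (\<lambda>x. P x \<and> Q x)"
  using recursive_mult[OF assms] by (simp add: of_bool_conj)

lemma recursive_of_bool_eq [recursive_intros]:
  assumes "recursive_on G A" and "recursive_on G B"
  shows "decidable_on G (\<lambda>x. A x = B x)"
proof -
  have "decidable_on G (\<lambda>x. A x \<le> B x \<and> B x \<le> A x)"
    by (intro recursive_intros assms)
  then show ?thesis by (simp add: eq_iff)
qed

lemma recursive_of_bool_disj [recursive_intros]:
  assumes "decidable_on G P" and "decidable_on G Q"
  shows "decidable_on G (\<lambda>x. P x \<or> Q x)"
  using recursive_of_bool_not[OF recursive_of_bool_conj[OF assms[THEN recursive_of_bool_not]]] by simp

lemma recursive_of_bool_imp [recursive_intros]:
  assumes "decidable_on G P" and "decidable_on G Q"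
  shows "decidable_on G (\<lambda>x. P x \<longrightarrow> Q x)"
  unfolding imp_conv_disj by (intro recursive_intros assms)

lemma recursive_of_bool_ball [recursive_intros]:
  assumes "recursive_on G N" and P: "decidable_on G (\<lambda>z. P (fst_of z) (snd_of z))"
  shows "decidable_on G (\<lambda>x. \<forall>i<N x. P i x)"
proof -
  have eq: "(of_bool (\<forall>i<n. P i x) :: nat) = rec_nat 1 (\<lambda>i r. r * of_bool (P i x)) n" for n x
  proof (induction n)
    case (Suc n)
    have "(of_bool (\<forall>i<Suc n. P i x) :: nat) = of_bool (\<forall>i<n. P i x) * of_bool (P n x)"
      by (auto simp: less_Suc_eq)
    then show ?case by (simp only: Suc old.nat.rec)
  qed simp
  have "recursive_on G (\<lambda>x. rec_nat 1 (\<lambda>i r. r * of_bool (P i x)) (N x))"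
    by (intro recursive_intros assms recursive_binary[OF P])
  then show ?thesis
    by (simp only: eq)
qed

lemma recursive_of_bool_bex [recursive_intros]:
  assumes N: "recursive_on G N" and P: "decidable_on G (\<lambda>z. P (fst_of z) (snd_of z))"
  shows "decidable_on G (\<lambda>x. \<exists>i<N x. P i x)"
proof -
  have "decidable_on G (\<lambda>x. \<not> (\<forall>i<N x. \<not> P i x))"
    by (intro recursive_of_bool_not recursive_of_bool_ball N P)
  then show ?thesis by simp
qed

lemma recursive_if [recursive_intros]:
  assumes "decidable_on G P" and "recursive_on G A" and "recursive_on G B"
  shows "recursive_on G (\<lambda>x. if P x then A x else B x)"
proof -
  have eq: "(if P x then A x else B x) = of_bool (P x) * A x + of_bool (\<not> P x) * B x" for x
    by simp
  show ?thesis
    unfolding eq by (intro recursive_intros assms)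
qed

lemma recursive_power [recursive_intros]:
  assumes "recursive_on G A" and "recursive_on G B"
  shows "recursive_on G (\<lambda>x. A x ^ B x)"
proof -
  have eq: "a ^ b = rec_nat 1 (\<lambda>_ r. r * a) b" for a b :: nat
    by (induction b) auto
  show ?thesis
    unfolding eq by (intro recursive_intros assms recursive_comp[OF assms(1)])
qed

lemma recursive_Least:
  assumes P: "decidable_on G (\<lambda>z. P (fst_of z) (snd_of z))" and ex: "\<And>x. \<exists>k. P k x"
  shows "recursive_on G (\<lambda>x. LEAST k. P k x)"
proof -
  \<comment> \<open>\<open>Mini\<close> searches for the value 0, so truth has to become 0.\<close>
  have "recursive_on G (\<lambda>z. 1 - of_bool (P (fst_of z) (snd_of z)))"
    by (intro recursive_intros P)
  then obtain p where p: "\<forall>g\<in>G. \<forall>z. run g p [z] = Some (1 - of_bool (P (fst_of z) (snd_of z)))"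
    unfolding recursive_on_def by blast
  have "run g (Mini (Comp p [pair_prog])) [x] = Some (LEAST k. P k x)" if "g \<in> G" for g x
  proof -
    have "run g (Comp p [pair_prog]) [k, x] = Some (1 - of_bool (P k x))" for k
      using p that by simp
    then show ?thesis
      using ex[of x] by auto
  qed
  then show ?thesis unfolding recursive_on_def by blast
qed

lemma recursive_div2 [recursive_intros]:
  assumes "recursive_on G A" shows "recursive_on G (\<lambda>x. A x div 2)"
proof -
  have "(LEAST k. x < 2 * k + 2) = x div 2" for x :: nat
    by (rule Least_equality) auto
  moreover have "recursive_on G (\<lambda>x. LEAST k. x < 2 * k + 2)"
    by (intro recursive_Least recursive_intros) presburger
  ultimately have "recursive_on G (\<lambda>x. x div 2)" by simp
  then show ?thesis using assms by (rule recursive_comp)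
qed

lemma recursive_of_bool_even [recursive_intros]:
  assumes "recursive_on G A" shows "decidable_on G (\<lambda>x. even (A x))"
proof -
  have eq: "even a \<longleftrightarrow> a = 2 * (a div 2)" for a :: nat by presburger
  show ?thesis
    unfolding eq by (intro recursive_intros assms)
qed

lemma recursive_oracle: "recursive_on {g} g"
  unfolding recursive_on_def by (rule exI[of _ Query]) simp

text \<open>Every number codes an infinite sequence, of which \<open>snd_of\<close> drops the first term; a finite list is
  coded by a prefix and its length.\<close>

definition entry :: "nat \<Rightarrow> nat \<Rightarrow> nat" where
  "entry w i = fst_of ((snd_of ^^ i) w)"

lemma entry_0 [simp]: "entry (prod_encode (a, w)) 0 = a"
  and entry_Suc [simp]: "entry (prod_encode (a, w)) (Suc i) = entry w i"
  by (simp_all add: entry_def funpow_Suc_right del: funpow.simps)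

lemma recursive_entry [recursive_intros]:
  assumes "recursive_on G A" and "recursive_on G B"
  shows "recursive_on G (\<lambda>x. entry (A x) (B x))"
proof -
  have eq: "(snd_of ^^ i) w = rec_nat w (\<lambda>_ r. snd_of r) i" for i w
    by (induction i) auto
  show ?thesis
    unfolding entry_def eq by (intro recursive_intros assms)
qed

lemma entry_surj: "\<exists>w. \<forall>i<n. entry w i = h i"
proof (induction n arbitrary: h)
  case (Suc n)
  obtain w where "\<forall>i<n. entry w i = h (Suc i)"
    using Suc[of "\<lambda>i. h (Suc i)"] by blast
  then have "\<forall>i<Suc n. entry (prod_encode (h 0, w)) i = h i"
    by (auto simp: less_Suc_eq_0_disj)
  then show ?case by blast
qed simp


section \<open>Rational arithmetic\<close>

definition rat_num :: "nat \<Rightarrow> real" where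
  "rat_num k = real_of_rat (nat_to_rat_surj k)"

lemma rat_num_between: "a < b \<Longrightarrow> \<exists>k. a < rat_num k \<and> rat_num k < b"
  unfolding rat_num_def by (metis of_rat_dense surj_nat_to_rat_surj surjD)

text \<open>Rational values are given exactly, as a difference of naturals over a positive natural,
  and not by approximations. This is what makes comparisons decidable.\<close>

definition recursive_real :: "(nat \<Rightarrow> nat) set \<Rightarrow> (nat \<Rightarrow> real) \<Rightarrow> bool" where
  "recursive_real G R \<longleftrightarrow> (\<exists>a b c. recursive_on G a \<and> recursive_on G b \<and> recursive_on G c \<and>
     (\<forall>x. c x > 0 \<and> R x = (real (a x) - real (b x)) / real (c x)))"

lemma recursive_realI:
  assumes "recursive_on G a" "recursive_on G b" "recursive_on G c" "\<And>x. c x > 0"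
    "\<And>x. R x = (real (a x) - real (b x)) / real (c x)"
  shows "recursive_real G R"
  using assms unfolding recursive_real_def by blast

lemma recursive_realE:
  assumes "recursive_real G R"
  obtains a b c where "recursive_on G a" "recursive_on G b" "recursive_on G c" "\<And>x. c x > 0"
    "\<And>x. R x = (real (a x) - real (b x)) / real (c x)"
  using assms unfolding recursive_real_def by blast

lemma recursive_real_comp:
  assumes "recursive_real G R" and "recursive_on G A"
  shows "recursive_real G (\<lambda>x. R (A x))"
proof -
  obtain a b c where abc: "recursive_on G a" "recursive_on G b" "recursive_on G c" "\<And>x. c x > 0"
    "\<And>x. R x = (real (a x) - real (b x)) / real (c x)"
    using assms(1) by (rule recursive_realE) blast
  show ?thesis
    by (rule recursive_realI[OF abc(1-3)[THEN recursive_comp, OF assms(2)]]) (use abc in auto)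
qed

lemma recursive_real_nat [recursive_intros]:
  assumes "recursive_on G A" shows "recursive_real G (\<lambda>x. real (A x))"
  by (rule recursive_realI[OF assms recursive_const[of G 0] recursive_const[of G 1]]) auto

lemma recursive_real_minus [recursive_intros]:
  assumes "recursive_real G R" shows "recursive_real G (\<lambda>x. - R x)"
proof -
  obtain a b c where abc: "recursive_on G a" "recursive_on G b" "recursive_on G c" "\<And>x. c x > 0"
    "\<And>x. R x = (real (a x) - real (b x)) / real (c x)"
    using assms(1) by (rule recursive_realE) blast
  show ?thesis
    by (rule recursive_realI[OF abc(2,1,3)]) (use abc in \<open>auto simp: field_simps\<close>)
qed

lemma recursive_real_add [recursive_intros]:
  assumes "recursive_real G R" "recursive_real G S" shows "recursive_real G (\<lambda>x. R x + S x)"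
proof -
  obtain a b c where abc: "recursive_on G a" "recursive_on G b" "recursive_on G c" "\<And>x. c x > 0"
    "\<And>x. R x = (real (a x) - real (b x)) / real (c x)"
    using assms(1) by (rule recursive_realE) blast
  obtain a' b' c' where abc': "recursive_on G a'" "recursive_on G b'" "recursive_on G c'" "\<And>x. c' x > 0"
    "\<And>x. S x = (real (a' x) - real (b' x)) / real (c' x)"
    using assms(2) by (rule recursive_realE) blast
  show ?thesis
  proof (rule recursive_realI)
    show "recursive_on G (\<lambda>x. a x * c' x + a' x * c x)" "recursive_on G (\<lambda>x. b x * c' x + b' x * c x)"
      "recursive_on G (\<lambda>x. c x * c' x)"
      by (intro recursive_intros abc abc')+
    fix x
    show "c x * c' x > 0" using abc(4) abc'(4) by simp
    show "R x + S x = (real (a x * c' x + a' x * c x) - real (b x * c' x + b' x * c x)) / real (c x * c' x)"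
      using abc(4)[of x] abc'(4)[of x] by (simp add: abc(5) abc'(5) field_simps)
  qed
qed

lemma recursive_real_diff [recursive_intros]:
  assumes "recursive_real G R" "recursive_real G S" shows "recursive_real G (\<lambda>x. R x - S x)"
  using recursive_real_add[OF assms(1) recursive_real_minus[OF assms(2)]] by simp

lemma recursive_real_half_power [recursive_intros]:
  assumes "recursive_on G A" shows "recursive_real G (\<lambda>x. (1 / 2) ^ A x)"
proof (rule recursive_realI)
  show "recursive_on G (\<lambda>_. 1)" "recursive_on G (\<lambda>_. 0)" "recursive_on G (\<lambda>x. 2 ^ A x)"
    by (intro recursive_intros assms)+
qed (auto simp: power_divide)

lemma recursive_real_sum [recursive_intros]:
  assumes R: "recursive_real G (\<lambda>z. R (fst_of z) (snd_of z))" and N: "recursive_on G N"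
  shows "recursive_real G (\<lambda>x. \<Sum>i<N x. R i x)"
proof -
  obtain a b c where abc: "recursive_on G a" "recursive_on G b" "recursive_on G c" "\<And>x. c x > 0"
    "\<And>z. R (fst_of z) (snd_of z) = (real (a z) - real (b z)) / real (c z)"
    using R by (rule recursive_realE) blast
  \<comment> \<open>\<open>C\<close> is the product of the first \<open>n\<close> denominators;
    \<open>A\<close> and \<open>B\<close> are the two parts of the numerator over this common
    denominator.\<close>
  define C where "C x n = rec_nat 1 (\<lambda>i r. r * c (prod_encode (i, x))) n" for x n
  define A where "A x n = rec_nat 0 (\<lambda>i r. r * c (prod_encode (i, x)) + a (prod_encode (i, x)) * C x i) n" for x n
  define B where "B x n = rec_nat 0 (\<lambda>i r. r * c (prod_encode (i, x)) + b (prod_encode (i, x)) * C x i) n" for x n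
  have C: "recursive_on G (\<lambda>x. C (H x) (K x))" if "recursive_on G H" "recursive_on G K" for H K
    unfolding C_def by (intro recursive_intros that recursive_comp[OF abc(3)] recursive_comp[OF that(1)])
  have A: "recursive_on G (\<lambda>x. A x (N x))"
    unfolding A_def by (intro recursive_intros N C recursive_comp[OF abc(3)] recursive_comp[OF abc(1)])
  have B: "recursive_on G (\<lambda>x. B x (N x))"
    unfolding B_def by (intro recursive_intros N C recursive_comp[OF abc(3)] recursive_comp[OF abc(2)])
  have *: "C x n > 0 \<and> (\<Sum>i<n. R i x) = (real (A x n) - real (B x n)) / real (C x n)" for x n
  proof (induction n)
    case 0
    show ?case by (simp add: A_def B_def C_def)
  next
    case (Suc n)
    have S: "C x (Suc n) = C x n * c (prod_encode (n, x))"
      "A x (Suc n) = A x n * c (prod_encode (n, x)) + a (prod_encode (n, x)) * C x n"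
      "B x (Suc n) = B x n * c (prod_encode (n, x)) + b (prod_encode (n, x)) * C x n"
      by (simp_all add: A_def B_def C_def)
    have "R n x = (real (a (prod_encode (n, x))) - real (b (prod_encode (n, x)))) / real (c (prod_encode (n, x)))"
      using abc(5)[of "prod_encode (n, x)"] by simp
    moreover have "c (prod_encode (n, x)) \<noteq> 0" "C x n \<noteq> 0"
      using Suc abc(4)[of "prod_encode (n, x)"] by auto
    ultimately show ?case
      using Suc abc(4)[of "prod_encode (n, x)"] by (simp add: S add_divide_distrib diff_divide_distrib)
  qed
  show ?thesis
    by (rule recursive_realI[OF A B C[OF recursive_id N]]) (use * in auto)
qed

lemma decidable_real_le [recursive_intros]:
  assumes "recursive_real G R" "recursive_real G S" shows "decidable_on G (\<lambda>x. R x \<le> S x)"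
proof -
  obtain a b c where abc: "recursive_on G a" "recursive_on G b" "recursive_on G c" "\<And>x. c x > 0"
    "\<And>x. R x = (real (a x) - real (b x)) / real (c x)"
    using assms(1) by (rule recursive_realE) blast
  obtain a' b' c' where abc': "recursive_on G a'" "recursive_on G b'" "recursive_on G c'" "\<And>x. c' x > 0"
    "\<And>x. S x = (real (a' x) - real (b' x)) / real (c' x)"
    using assms(2) by (rule recursive_realE) blast
  have "R x \<le> S x \<longleftrightarrow> a x * c' x + b' x * c x \<le> a' x * c x + b x * c' x" for x
  proof -
    have "R x \<le> S x \<longleftrightarrow> (real (a x) - real (b x)) * real (c' x) \<le> (real (a' x) - real (b' x)) * real (c x)"
      using abc(4)[of x] abc'(4)[of x] by (simp add: abc(5) abc'(5) divide_simps)
    also have "\<dots> \<longleftrightarrow> real (a x * c' x + b' x * c x) \<le> real (a' x * c x + b x * c' x)"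
      by (simp add: algebra_simps)
    finally show ?thesis by (simp only: of_nat_le_iff)
  qed
  then show ?thesis
    by (simp only:) (intro recursive_intros abc abc')
qed

lemma decidable_real_less [recursive_intros]:
  assumes "recursive_real G R" "recursive_real G S" shows "decidable_on G (\<lambda>x. R x < S x)"
  using recursive_of_bool_not[OF decidable_real_le[OF assms(2,1)]] by (simp add: not_le)

lemma recursive_real_rat_num [recursive_intros]:
  assumes "recursive_on G A" shows "recursive_real G (\<lambda>x. rat_num (A x))"
proof -
  define pos where "pos n = (if even n then n div 2 else 0)" for n :: nat
  define neg where "neg n = (if even n then 0 else Suc (n div 2))" for n :: nat
  have pos: "recursive_on G (\<lambda>x. pos (H x))" and neg: "recursive_on G (\<lambda>x. neg (H x))"
    if "recursive_on G H" for H
    unfolding pos_def neg_def by (intro recursive_intros that)+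
  have dec: "real_of_int (int_decode n) = real (pos n) - real (neg n)" for n
    by (auto simp: pos_def neg_def int_decode_def sum_decode_def)
  \<comment> \<open>The sign of the denominator is moved into the numerator by swapping its two
    parts. A zero denominator yields 0 over 1, in accordance with division by zero.\<close>
  define a where "a k = (if 0 < pos (snd_of k) then pos (fst_of k) else if 0 < neg (snd_of k) then neg (fst_of k) else 0)" for k
  define b where "b k = (if 0 < pos (snd_of k) then neg (fst_of k) else if 0 < neg (snd_of k) then pos (fst_of k) else 0)" for k
  define c where "c k = (if 0 < pos (snd_of k) then pos (snd_of k) else if 0 < neg (snd_of k) then neg (snd_of k) else 1)" for k
  have "rat_num k = real_of_int (int_decode (fst_of k)) / real_of_int (int_decode (snd_of k))" for k
    by (simp add: rat_num_def nat_to_rat_surj_def fst_of_def snd_of_def of_rat_rat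
        split: prod.split)
      (metis Fract_of_int_quotient of_rat_divide of_rat_of_int_eq)
  then have eq: "rat_num k = (real (a k) - real (b k)) / real (c k)" for k
    unfolding dec by (auto simp: a_def b_def c_def pos_def neg_def field_simps)
  have "recursive_real G rat_num"
  proof (rule recursive_realI[OF _ _ _ _ eq])
    show "recursive_on G a" "recursive_on G b" "recursive_on G c"
      unfolding a_def b_def c_def by (intro recursive_intros pos neg)+
  qed (auto simp: c_def)
  then show ?thesis using assms by (rule recursive_real_comp)
qed


section \<open>Kleene's basis theorem\<close>

text \<open>A finite sequence is coded together with its length: nodes of a tree on the natural numbers
  are pairs \<open>n s\<close>, where \<open>s\<close> codes a sequence of length \<open>n\<close>, last term first. The path through
  \<open>\<alpha>\<close> consists of the nodes \<open>n (prefix_code \<alpha> n)\<close>.\<close>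

primrec prefix_code :: "(nat \<Rightarrow> nat) \<Rightarrow> nat \<Rightarrow> nat" where
  "prefix_code \<alpha> 0 = 0"
| "prefix_code \<alpha> (Suc n) = prod_encode (\<alpha> n, prefix_code \<alpha> n)"

lemma entry_prefix_code: "i < n \<Longrightarrow> entry (prefix_code \<alpha> n) (n - Suc i) = \<alpha> i"
proof (induction n)
  case (Suc n)
  then show ?case
    by (cases "i = n") (auto simp: Suc_diff_Suc simp flip: Suc_diff_Suc)
qed simp

text \<open>The inductive form of well-foundedness: every infinite branch through the node violates
  \<open>P\<close> at the node or beyond it. Derivations follow the tree, so notations can be built
  along them.\<close>

inductive barred :: "(nat \<Rightarrow> nat \<Rightarrow> bool) \<Rightarrow> nat \<Rightarrow> nat \<Rightarrow> bool" for P where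
  leaf: "\<not> P n s \<Longrightarrow> barred P n s"
| node: "(\<And>k. barred P (Suc n) (prod_encode (k, s))) \<Longrightarrow> barred P n s"

lemma barred_no_path:
  "barred P n s \<Longrightarrow> prefix_code \<alpha> n = s \<Longrightarrow> \<exists>m. \<not> P m (prefix_code \<alpha> m)"
proof (induction rule: barred.induct)
  case (node n s)
  then show ?case by (metis prefix_code.simps(2))
qed blast

text \<open>Plays the part of the s-m-n theorem: a parameter is wired into a program as a constant,
  and the code of the result depends recursively on the parameter.\<close>

definition const_prog_code :: "nat \<Rightarrow> nat" where
  "const_prog_code v = prog_code (const_prog v)"

lemma recursive_const_prog_code [recursive_intros]:
  assumes "recursive_on G A" shows "recursive_on G (\<lambda>x. const_prog_code (A x))"
proof -
  have eq: "const_prog_code v = rec_nat (prod_encode (0, 0))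
      (\<lambda>_ r. prod_encode (4, prod_encode (prod_encode (1, 0), Suc (prod_encode (r, 0))))) v" for v
    by (induction v) (simp_all add: const_prog_code_def)
  show ?thesis
    unfolding eq by (intro recursive_intros assms)
qed

text \<open>The code of the fundamental sequence calls the function to be defined. This self-reference is
  resolved as in the recursion theorem: the first component of the argument \<open>z\<close> of \<open>Q\<close> below is the
  code of the program to be called, and the program \<open>q\<close> for \<open>Q\<close> is run on its own code. As the programs involved are only assembled and never decoded,
  no universal program is needed.\<close>

lemma notation_assignment:
  assumes P: "decidable_on UNIV (\<lambda>z. P (fst_of z) (snd_of z))"
  obtains N :: "nat \<Rightarrow> nat \<Rightarrow> nat \<Rightarrow> nat" where
    "recursive_on UNIV (\<lambda>z. N (fst_of z) (fst_of (snd_of z)) (snd_of (snd_of z)))"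
    "\<And>n s a. \<not> P n s \<Longrightarrow> N n s a = 2 ^ a"
    "\<And>n s a. P n s \<Longrightarrow> \<exists>e b. N n s a = 3 * 5 ^ e \<and> (\<forall>j. phi e j = Some (b j)) \<and>
       b 0 = a \<and> (\<forall>j. b (Suc j) = N (Suc n) (prod_encode (j, s)) (b j))"
proof -
  \<comment> \<open>With \<open>z\<close> coding \<open>(c, n, s, a)\<close>, the triple
    \<open>(k, r, z)\<close> becomes the argument \<open>(c, n + 1, (k, s), r)\<close> of the call
    for child \<open>k\<close> above the notation \<open>r\<close>.\<close>
  define m where "m w = (let k = fst_of w; r = fst_of (snd_of w); z = snd_of (snd_of w) in
     prod_encode (fst_of z, prod_encode (Suc (fst_of (snd_of z)),
       prod_encode (prod_encode (k, fst_of (snd_of (snd_of z))), r))))" for w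
  have "recursive_on UNIV m"
    unfolding m_def Let_def by (intro recursive_intros)
  then obtain pm where pm: "\<And>g x. run g pm [x] = Some (m x)"
    unfolding recursive_on_def by blast
  define M where "M = Comp pm [Comp pair_prog [Proj 0, Comp pair_prog [Proj 1, Proj 2]]]"
  \<comment> \<open>The fundamental sequence: it starts at the notation \<open>a\<close> stored in
    \<open>z\<close>, and step \<open>k\<close> climbs over child \<open>k\<close>.\<close>
  define B where "B q z = Prec (const_prog (snd_of (snd_of (snd_of z))))
     (Comp q [Comp M [Proj 0, Proj 1, const_prog z]])" for q z
  \<comment> \<open>The code of \<open>B q z\<close> written out arithmetically, with
    \<open>fst_of z\<close> in place of the code of \<open>q\<close>. Hence \<open>E\<close> is
    recursive before \<open>q\<close> is known.\<close>
  define E where "E z = prod_encode (5, prod_encode (const_prog_code (snd_of (snd_of (snd_of z))),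
     prod_encode (4, prod_encode (fst_of z, Suc (prod_encode
       (prod_encode (4, prod_encode (prog_code M, Suc (prod_encode (prog_code (Proj 0),
          Suc (prod_encode (prog_code (Proj 1), Suc (prod_encode (const_prog_code z, 0)))))))), 0))))))" for z
  have E: "E z = prog_code (B q z)" if "fst_of z = prog_code q" for q z
    unfolding E_def B_def using that by (simp add: const_prog_code_def)
  define Q where "Q z = (if P (fst_of (snd_of z)) (fst_of (snd_of (snd_of z)))
     then 3 * 5 ^ E z else 2 ^ snd_of (snd_of (snd_of z)) :: nat)" for z
  have "recursive_on UNIV Q"
    unfolding Q_def E_def by (intro recursive_intros recursive_binary[OF P])
  then obtain q where q: "\<And>g x. run g q [x] = Some (Q x)"
    unfolding recursive_on_def by blast
  define N where "N n s a = Q (prod_encode (prog_code q, prod_encode (n, prod_encode (s, a))))" for n s a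
  show ?thesis
  proof (rule that)
    show "recursive_on UNIV (\<lambda>z. N (fst_of z) (fst_of (snd_of z)) (snd_of (snd_of z)))"
      unfolding N_def by (rule recursive_comp[OF \<open>recursive_on UNIV Q\<close>]) (intro recursive_intros)
    show "\<not> P n s \<Longrightarrow> N n s a = 2 ^ a" for n s a
      by (simp add: N_def Q_def)
    fix n s a assume "P n s"
    define z where "z = prod_encode (prog_code q, prod_encode (n, prod_encode (s, a)))"
    define b where "b = rec_nat a (\<lambda>j r. N (Suc n) (prod_encode (j, s)) r)"
    have "N n s a = 3 * 5 ^ E z"
      using \<open>P n s\<close> by (simp add: N_def Q_def z_def)
    moreover have "phi (E z) j = Some (b j)" for j
    proof -
      have "run g (Comp q [Comp M [Proj 0, Proj 1, const_prog z]]) [k, r] =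
          Some (N (Suc n) (prod_encode (k, s)) r)" for g k r
        by (simp add: M_def pm q m_def z_def N_def)
      then have "run g (B q z) [j] = Some (b j)" for g
        by (induction j) (auto simp: B_def b_def z_def)
      moreover have "E z = prog_code (B q z)"
        by (rule E) (simp add: z_def)
      ultimately show ?thesis
        by (simp add: phi_def inv_f_f[OF inj_prog_code])
    qed
    ultimately show "\<exists>e b. N n s a = 3 * 5 ^ e \<and> (\<forall>j. phi e j = Some (b j)) \<and>
       b 0 = a \<and> (\<forall>j. b (Suc j) = N (Suc n) (prod_encode (j, s)) (b j))"
      by (intro exI[of _ "E z"] exI[of _ b]) (simp add: b_def)
  qed
qed

text \<open>A power of 2 is 1 or 2 modulo 3. So successor and limit notations never coincide, and
  the shape of an assigned notation reveals whether the node satisfies \<open>P\<close>.\<close>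

lemma pow2_neq_3_mult: "(2::nat) ^ a \<noteq> 3 * k"
proof -
  have "(2::nat) ^ a mod 3 = 1 \<or> (2::nat) ^ a mod 3 = 2"
    by (induction a) (simp, simp only: power_Suc, presburger)
  then show ?thesis by auto
qed

text \<open>The number \<open>N n s a\<close> assigned to a node of a well-founded tree is a notation above \<open>a\<close>: the limit
  of the notations obtained from \<open>a\<close> by climbing successively over the children of the node.\<close>

lemma barred_reducible_to_O:
  assumes P: "decidable_on UNIV (\<lambda>z. P (fst_of z) (snd_of z))"
  obtains H :: "nat \<Rightarrow> nat \<Rightarrow> nat" where
    "recursive_on UNIV (\<lambda>z. H (fst_of z) (snd_of z))" "\<And>n s. barred P n s \<longleftrightarrow> H n s \<in> Kleene_O"
proof -
  obtain N :: "nat \<Rightarrow> nat \<Rightarrow> nat \<Rightarrow> nat" where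
    rec: "recursive_on UNIV (\<lambda>z. N (fst_of z) (fst_of (snd_of z)) (snd_of (snd_of z)))" and
    N_leaf: "\<And>n s a. \<not> P n s \<Longrightarrow> N n s a = 2 ^ a" and
    N_node: "\<And>n s a. P n s \<Longrightarrow> \<exists>e b. N n s a = 3 * 5 ^ e \<and> (\<forall>j. phi e j = Some (b j)) \<and>
       b 0 = a \<and> (\<forall>j. b (Suc j) = N (Suc n) (prod_encode (j, s)) (b j))"
    using notation_assignment[OF P] by blast
  \<comment> \<open>The base notation \<open>a\<close> must stay arbitrary in the induction, because
    the children of a node start from different members of the sequence \<open>b\<close>.\<close>
  have 1: "in_O (N n s a) \<and> less_O a (N n s a)" if "barred P n s" "in_O a" for n s a
    using that
  proof (induction arbitrary: a rule: barred.induct)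
    case (leaf n s)
    then show ?case
      using N_leaf[of n s a] by (auto intro: in_O_less_O.intros)
  next
    case (node n s)
    show ?case
    proof (cases "P n s")
      case False
      then show ?thesis
        using N_leaf[of n s a] \<open>in_O a\<close> by (auto intro: in_O_less_O.intros)
    next
      case True
      then obtain e b where e: "N n s a = 3 * 5 ^ e" "\<And>j. phi e j = Some (b j)" "b 0 = a"
        "\<And>j. b (Suc j) = N (Suc n) (prod_encode (j, s)) (b j)"
        using N_node[of n s a] by metis
      have in_O: "in_O (b j)" for j
        by (induction j) (use e(3,4) \<open>in_O a\<close> node.IH in auto)
      then have less: "less_O (b j) (b (Suc j))" for j
        using node.IH e(4) by simp
      have "in_O (3 * 5 ^ e)"
        using e(2) in_O less by (rule O_lim)
      \<comment> \<open>A member of the sequence strictly above \<open>a\<close> is required;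
        \<open>b 0\<close> is \<open>a\<close> itself, so the member with index 1 is taken.\<close>
      moreover from this have "less_O a (3 * 5 ^ e)"
        using less_O_lim[OF _ e(2)[of "Suc 0"]] less[of 0] e(3) by auto
      ultimately show ?thesis
        using e(1) by simp
    qed
  qed
  \<comment> \<open>Conversely, induction on membership in \<open>in_O\<close> rebuilds a bar: equal
    limit notations have equal indices \<open>e\<close>, so the sequence in the rule is
    \<open>b\<close>, whose successive members are the notations of the children.\<close>
  have 2: "\<forall>n s a. x = N n s a \<longrightarrow> barred P n s" if "in_O x" for x
    using that
  proof (induction x rule: in_O_less_O.inducts(1)[where ?P2.0 = "\<lambda>_ _. True"])
    case O_zero
    show ?case
    proof (intro allI impI)
      fix n s a assume *: "1 = N n s a"
      have "\<not> P n s"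
      proof
        assume "P n s"
        then obtain e where "N n s a = 3 * 5 ^ e"
          using N_node[of n s a] by blast
        with * show False by simp
      qed
      then show "barred P n s" by (rule barred.leaf)
    qed
  next
    case (O_suc y)
    show ?case
    proof (intro allI impI)
      fix n s a assume *: "2 ^ y = N n s a"
      have "\<not> P n s"
      proof
        assume "P n s"
        then obtain e where "N n s a = 3 * 5 ^ e"
          using N_node[of n s a] by blast
        with * show False by (simp add: pow2_neq_3_mult)
      qed
      then show "barred P n s" by (rule barred.leaf)
    qed
  next
    case (O_lim e h)
    show ?case
    proof (intro allI impI)
      fix n s a assume *: "3 * 5 ^ e = N n s a"
      show "barred P n s"
      proof (cases "P n s")
        case True
        then obtain e' b where e': "N n s a = 3 * 5 ^ e'" "\<And>j. phi e' j = Some (b j)"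
          "\<And>j. b (Suc j) = N (Suc n) (prod_encode (j, s)) (b j)"
          using N_node[of n s a] by metis
        have "e' = e"
          using * e'(1) by simp
        then have "b j = h j" for j
          using e'(2)[of j] O_lim(1)[of j] by simp
        then have "h (Suc j) = N (Suc n) (prod_encode (j, s)) (h j)" for j
          using e'(3)[of j] by simp
        then have "barred P (Suc n) (prod_encode (j, s))" for j
          using O_lim.IH by blast
        then show ?thesis by (rule barred.node)
      qed (rule barred.leaf)
    qed
  qed auto
  show ?thesis
  proof (rule that)
    show "recursive_on UNIV (\<lambda>z. N (fst_of z) (snd_of z) 1)"
      using recursive_comp[OF rec, of "\<lambda>z. prod_encode (fst_of z, prod_encode (snd_of z, 1))"]
      by (simp add: recursive_intros)
    show "barred P n s \<longleftrightarrow> N n s 1 \<in> Kleene_O" for n s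
      using 1[OF _ O_zero] 2 unfolding Kleene_O_def by blast
  qed
qed

abbreviation O_oracle :: "(nat \<Rightarrow> nat) set" where
  "O_oracle \<equiv> {\<lambda>k. of_bool (k \<in> Kleene_O)}"

lemma computable_in_O_iff: "computable_in Kleene_O h \<longleftrightarrow> recursive_on O_oracle h"
  by (simp add: computable_in_def recursive_on_def)

text \<open>The leftmost unbarred branch works. An unbarred node satisfies \<open>P\<close> and has
  an unbarred child, and the oracle decides which children are barred. The path
  \<open>\<beta>\<close> shows that the root is unbarred.\<close>

theorem O_basis:
  assumes P: "decidable_on UNIV (\<lambda>z. P (fst_of z) (snd_of z))"
    and path: "\<And>n. P n (prefix_code \<beta> n)"
  obtains \<alpha> where "recursive_on O_oracle \<alpha>" "\<And>n. P n (prefix_code \<alpha> n)"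
proof -
  obtain H :: "nat \<Rightarrow> nat \<Rightarrow> nat" where
    H: "recursive_on UNIV (\<lambda>z. H (fst_of z) (snd_of z))" "\<And>n s. barred P n s \<longleftrightarrow> H n s \<in> Kleene_O"
    using barred_reducible_to_O[OF P] by blast
  have "decidable_on O_oracle (\<lambda>k. k \<in> Kleene_O)"
    using recursive_oracle[of "\<lambda>k. of_bool (k \<in> Kleene_O)"] .
  from recursive_comp[OF this recursive_on_UNIV[OF H(1)]]
  have bar: "decidable_on O_oracle (\<lambda>z. barred P (fst_of z) (snd_of z))"
    by (simp add: H(2))
  \<comment> \<open>The first disjunct makes the search total; the branch itself never visits a
    barred node.\<close>
  define Ext where "Ext k z \<longleftrightarrow> barred P (fst_of z) (snd_of z) \<or>
    \<not> barred P (Suc (fst_of z)) (prod_encode (k, snd_of z))" for k z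
  define next_of where "next_of z = (LEAST k. Ext k z)" for z
  have ex: "\<exists>k. Ext k z" for z
    using barred.node[of P "fst_of z" "snd_of z"] unfolding Ext_def by blast
  have rec_next: "recursive_on O_oracle next_of"
    unfolding next_of_def
  proof (rule recursive_Least[OF _ ex])
    show "decidable_on O_oracle (\<lambda>z. Ext (fst_of z) (snd_of z))"
      unfolding Ext_def by (intro recursive_intros recursive_binary[OF bar])
  qed
  define S where "S n = rec_nat 0 (\<lambda>n s. prod_encode (next_of (prod_encode (n, s)), s)) n" for n
  have rec_S: "recursive_on O_oracle (\<lambda>x. S x)"
    unfolding S_def by (intro recursive_intros recursive_comp[OF rec_next])
  define \<alpha> where "\<alpha> n = next_of (prod_encode (n, S n))" for n
  have S: "prefix_code \<alpha> n = S n" for n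
    by (induction n) (simp_all add: S_def \<alpha>_def)
  have "\<not> barred P n (prefix_code \<alpha> n)" for n
  proof (induction n)
    case 0
    show ?case
      using barred_no_path[of P 0 0 \<beta>] path by auto
  next
    case (Suc n)
    have "Ext (\<alpha> n) (prod_encode (n, S n))"
      unfolding \<alpha>_def next_of_def by (rule LeastI_ex[OF ex])
    then show ?case
      using Suc by (simp add: Ext_def S)
  qed
  then have "P n (prefix_code \<alpha> n)" for n
    using barred.leaf by blast
  moreover have "recursive_on O_oracle \<alpha>"
    unfolding \<alpha>_def by (intro recursive_intros recursive_comp[OF rec_next] rec_S)
  ultimately show ?thesis using that by blast
qed

lemma O_decides_universal:
  assumes R: "decidable_on UNIV (\<lambda>z. R (fst_of z) (snd_of z))"
  shows "decidable_on O_oracle (\<lambda>x. \<forall>y. R x y)"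
proof -
  text \<open>The unique solution up to the choice of counterexamples: \<open>\<alpha> x = 0\<close> asserts \<open>\<forall>y. R x y\<close>, and
    \<open>\<alpha> x = Suc k\<close> asserts \<open>\<not> R x k\<close>. The stage \<open>n = Suc (prod_encode (x, y))\<close> checks the pair.\<close>
  define ok where "ok x y a \<longleftrightarrow> (a = 0 \<longrightarrow> R x y) \<and> (a \<noteq> 0 \<longrightarrow> \<not> R x (a - 1))" for x y a
  define P where "P n s \<longleftrightarrow> n = 0 \<or>
    ok (fst_of (n - 1)) (snd_of (n - 1)) (entry s (n - Suc (fst_of (n - 1))))" for n s
  have P: "decidable_on UNIV (\<lambda>z. P (fst_of z) (snd_of z))"
    unfolding P_def ok_def by (intro recursive_intros recursive_binary[OF R])
  have P_iff: "(\<forall>n. P n (prefix_code \<alpha> n)) \<longleftrightarrow> (\<forall>x y. ok x y (\<alpha> x))" for \<alpha>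
  proof -
    \<comment> \<open>A pair is at least as large as its first component, so at this stage the
      answer for \<open>fst_of j\<close> is already part of the sequence.\<close>
    have "P (Suc j) (prefix_code \<alpha> (Suc j)) \<longleftrightarrow> ok (fst_of j) (snd_of j) (\<alpha> (fst_of j))" for j
      using entry_prefix_code[of "fst_of j" "Suc j" \<alpha>] fst_of_le[of j] by (simp add: P_def)
    then have "(\<forall>n. P n (prefix_code \<alpha> n)) \<longleftrightarrow> (\<forall>j. ok (fst_of j) (snd_of j) (\<alpha> (fst_of j)))"
      by (metis P_def not0_implies_Suc)
    also have "\<dots> \<longleftrightarrow> (\<forall>x y. ok x y (\<alpha> x))"
      by (metis fst_of_pair snd_of_pair)
    finally show ?thesis .
  qed
  define \<beta> where "\<beta> x = (if \<forall>y. R x y then 0 else Suc (SOME k. \<not> R x k))" for x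
  have "ok x y (\<beta> x)" for x y
    using someI_ex[of "\<lambda>k. \<not> R x k"] by (auto simp: ok_def \<beta>_def)
  then have "\<And>n. P n (prefix_code \<beta> n)"
    using P_iff by blast
  from O_basis[OF P this] obtain \<alpha> where \<alpha>: "recursive_on O_oracle \<alpha>" "\<And>n. P n (prefix_code \<alpha> n)"
    by blast
  then have "ok x y (\<alpha> x)" for x y
    using P_iff by blast
  then have "(\<forall>y. R x y) \<longleftrightarrow> \<alpha> x = 0" for x
    unfolding ok_def by blast
  then show ?thesis
    by (simp only:) (intro recursive_intros \<alpha>)
qed


section \<open>Computable real functions\<close>

lemma those_eq_Some_iff:
  "those xs = Some ys \<longleftrightarrow> length xs = length ys \<and> (\<forall>i<length xs. xs ! i = Some (ys ! i))"
proof (induction xs arbitrary: ys)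
  case (Cons x xs)
  show ?case
    by (cases x; cases ys) (auto simp: Cons nth_Cons' less_Suc_eq_0_disj)
qed auto

lemma those_map_mono:
  assumes "those (map F qs) = Some ys" and "\<And>q y. q \<in> set qs \<Longrightarrow> F q = Some y \<Longrightarrow> F' q = Some y"
  shows "those (map F' qs) = Some ys"
  using assms by (auto simp: those_eq_Some_iff)

lemma run_Mini_eq_SomeD:
  assumes "run g (Mini p) xs = Some n"
  shows "run g p (n # xs) = Some 0" and "\<And>m. m < n \<Longrightarrow> \<exists>v. run g p (m # xs) = Some (Suc v)"
proof -
  from assms have ex: "\<exists>n. run g p (n # xs) = Some 0 \<and> (\<forall>m<n. run g p (m # xs) \<noteq> None)"
    and n: "n = (LEAST n. run g p (n # xs) = Some 0)"
    by (auto split: if_splits)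
  then obtain n' where n': "run g p (n' # xs) = Some 0" "\<forall>m<n'. run g p (m # xs) \<noteq> None"
    by blast
  show "run g p (n # xs) = Some 0"
    unfolding n using n'(1) by (rule LeastI)
  fix m assume m: "m < n"
  have "n \<le> n'"
    unfolding n using n'(1) by (rule Least_le)
  with m n'(2) have "run g p (m # xs) \<noteq> None" by auto
  moreover have "run g p (m # xs) \<noteq> Some 0"
    using m unfolding n by (rule not_less_Least)
  ultimately show "\<exists>v. run g p (m # xs) = Some (Suc v)"
    by (metis not0_implies_Suc option.exhaust)
qed

lemma run_Mini_eq_SomeI:
  assumes "run g p (n # xs) = Some 0" and "\<And>m. m < n \<Longrightarrow> \<exists>v. run g p (m # xs) = Some (Suc v)"
  shows "run g (Mini p) xs = Some n"
proof -
  have "(LEAST n. run g p (n # xs) = Some 0) = n"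
    using assms by (intro Least_equality) (force simp: not_less[symmetric])+
  moreover have "\<exists>n. run g p (n # xs) = Some 0 \<and> (\<forall>m<n. run g p (m # xs) \<noteq> None)"
    using assms by force
  ultimately show ?thesis by simp
qed

text \<open>A halting computation makes finitely many queries. A bound for the whole is the maximum
  of bounds for the subcomputations; a search with result \<open>y\<close> evaluates only the
  arguments up to \<open>y\<close>.\<close>

lemma run_use:
  assumes "run g p xs = Some y"
  shows "\<exists>m. \<forall>g'. (\<forall>i<m. g' i = g i) \<longrightarrow> run g' p xs = Some y"
  using assms
proof (induction p arbitrary: xs y)
  case Query
  then show ?case
    by (cases xs) auto
next
  case (Comp p qs)
  then obtain ys where ys: "those (map (\<lambda>q. run g q xs) qs) = Some ys" "run g p ys = Some y"
    by (auto simp: bind_eq_Some_conv)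
  obtain m where m: "\<And>g'. \<forall>i<m. g' i = g i \<Longrightarrow> run g' p ys = Some y"
    using Comp.IH(1)[OF ys(2)] by blast
  have "\<exists>m. \<forall>g'. (\<forall>i<m. g' i = g i) \<longrightarrow> (\<forall>y. run g q xs = Some y \<longrightarrow> run g' q xs = Some y)"
    if "q \<in> set qs" for q
    using Comp.IH(2)[OF that] by (cases "run g q xs") auto
  then obtain M where M: "\<And>q g' y. q \<in> set qs \<Longrightarrow> \<forall>i<M q. g' i = g i \<Longrightarrow> run g q xs = Some y \<Longrightarrow>
      run g' q xs = Some y"
    by metis
  define m' where "m' = Max (insert m (M ` set qs))"
  have "run g' (Comp p qs) xs = Some y" if g': "\<forall>i<m'. g' i = g i" for g'
  proof -
    have "m \<le> m'"
      unfolding m'_def by simp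
    then have "run g' p ys = Some y"
      using g' by (intro m) auto
    moreover have *: "\<forall>i<M q. g' i = g i" if "q \<in> set qs" for q
    proof -
      have "M q \<le> m'"
        unfolding m'_def using that by simp
      then show ?thesis using g' by auto
    qed
    have "those (map (\<lambda>q. run g' q xs) qs) = Some ys"
      by (rule those_map_mono[OF ys(1)]) (rule M[OF _ *])
    ultimately show ?thesis by simp
  qed
  then show ?case by blast
next
  case (Prec p q)
  then obtain n ys where xs: "xs = n # ys" by (cases xs) auto
  have "\<exists>m. \<forall>g'. (\<forall>i<m. g' i = g i) \<longrightarrow> run g' (Prec p q) (n # ys) = Some y"
    if "run g (Prec p q) (n # ys) = Some y" for y
    using that
  proof (induction n arbitrary: y)
    case 0
    then show ?case using Prec.IH(1)[of ys y] by simp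
  next
    case (Suc n)
    then obtain z where z: "run g (Prec p q) (n # ys) = Some z" "run g q (n # z # ys) = Some y"
      by (auto simp: bind_eq_Some_conv)
    obtain m where m: "\<And>g'. \<forall>i<m. g' i = g i \<Longrightarrow> run g' (Prec p q) (n # ys) = Some z"
      using Suc.IH[OF z(1)] by blast
    obtain m' where m': "\<And>g'. \<forall>i<m'. g' i = g i \<Longrightarrow> run g' q (n # z # ys) = Some y"
      using Prec.IH(2)[OF z(2)] by blast
    have "run g' (Prec p q) (Suc n # ys) = Some y" if "\<forall>i<max m m'. g' i = g i" for g'
      using m[of g'] m'[of g'] that by auto
    then show ?case by blast
  qed
  then show ?case using Prec.prems xs by blast
next
  case (Mini p)
  have "\<exists>v. run g p (m # xs) = Some v" if "m \<le> y" for m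
    using run_Mini_eq_SomeD[OF Mini.prems] that by (metis le_neq_implies_less)
  then have "\<forall>m\<le>y. \<exists>k. \<forall>g'. (\<forall>i<k. g' i = g i) \<longrightarrow> run g' p (m # xs) = run g p (m # xs)"
    using Mini.IH by metis
  then obtain M where M: "\<And>m g'. m \<le> y \<Longrightarrow> \<forall>i<M m. g' i = g i \<Longrightarrow> run g' p (m # xs) = run g p (m # xs)"
    by metis
  define k where "k = Max (M ` {..y})"
  have "run g' (Mini p) xs = Some y" if g': "\<forall>i<k. g' i = g i" for g'
  proof -
    have "M m \<le> k" if "m \<le> y" for m
      unfolding k_def using that by auto
    then have *: "run g' p (m # xs) = run g p (m # xs)" if "m \<le> y" for m
      using M that g' by (meson less_le_trans)
    show ?thesis
      by (rule run_Mini_eq_SomeI) (use * run_Mini_eq_SomeD[OF Mini.prems] in auto)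
  qed
  then show ?case by blast
qed auto

text \<open>\<open>const_oracle k p\<close> is run on lists of length \<open>k + 1\<close>, the last entry being the value of a
  constant oracle.\<close>

fun const_oracle :: "nat \<Rightarrow> prog \<Rightarrow> prog" where
  "const_oracle k Query = Proj k"
| "const_oracle k (Comp p qs) =
     Comp (const_oracle (length qs) p) (map (const_oracle k) qs @ [Proj k])"
| "const_oracle k (Prec p q) = Prec (const_oracle (k - 1) p) (const_oracle (k + 1) q)"
| "const_oracle k (Mini p) = Mini (const_oracle (k + 1) p)"
| "const_oracle k p = p"

text \<open>Only defined runs are transferred, since the additional last argument can make an
  undefined projection defined.\<close>

lemma run_const_oracle:
  "run (\<lambda>_. c) p xs = Some y \<Longrightarrow> run g (const_oracle (length xs) p) (xs @ [c]) = Some y"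
proof (induction p arbitrary: xs y)
  case Succ
  then show ?case by (cases xs) auto
next
  case (Proj i)
  then show ?case by (auto simp: nth_append split: if_splits)
next
  case Query
  then show ?case by (cases xs) auto
next
  case (Comp p qs)
  then obtain ys where ys: "those (map (\<lambda>q. run (\<lambda>_. c) q xs) qs) = Some ys" "run (\<lambda>_. c) p ys = Some y"
    by (auto simp: bind_eq_Some_conv)
  have len: "length qs = length ys"
    using ys(1) by (simp add: those_eq_Some_iff)
  have "those (map (\<lambda>q. run g q (xs @ [c])) (map (const_oracle (length xs)) qs @ [Proj (length xs)])) =
      Some (ys @ [c])"
    using ys(1) len Comp.IH(2) by (auto simp: those_eq_Some_iff nth_append less_Suc_eq)
  then show ?case
    using Comp.IH(1)[OF ys(2)] by (simp add: len)
next
  case (Prec p q)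
  then obtain n ys where xs: "xs = n # ys" by (cases xs) auto
  have "run g (const_oracle (Suc (length ys)) (Prec p q)) (n # ys @ [c]) = Some y"
    if "run (\<lambda>_. c) (Prec p q) (n # ys) = Some y" for y
    using that
  proof (induction n arbitrary: y)
    case 0
    then show ?case using Prec.IH(1)[of ys y] by simp
  next
    case (Suc n)
    then obtain z where z: "run (\<lambda>_. c) (Prec p q) (n # ys) = Some z" "run (\<lambda>_. c) q (n # z # ys) = Some y"
      by (auto simp: bind_eq_Some_conv)
    then show ?case
      using Suc.IH[OF z(1)] Prec.IH(2)[OF z(2)] by simp
  qed
  then show ?case using Prec.prems xs by simp
next
  case (Mini p)
  have IH: "run (\<lambda>_. c) p (m # xs) = Some v \<Longrightarrow>
      run g (const_oracle (Suc (length xs)) p) (m # xs @ [c]) = Some v" for m v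
    using Mini.IH[of "m # xs" v] by simp
  have "run g (Mini (const_oracle (Suc (length xs)) p)) (xs @ [c]) = Some y"
    by (rule run_Mini_eq_SomeI) (use IH run_Mini_eq_SomeD[OF Mini.prems] in blast)+
  then show ?case by simp
qed auto

text \<open>The constant sequence \<open>q\<close> is a Cauchy name of \<open>rat_num q\<close>. A
  constant oracle can be replaced by an ordinary argument, which makes the approximation recursive
  in \<open>q\<close> and the precision together.\<close>

lemma computable_real_fun_on_rationals:
  assumes "computable_real_fun f"
  obtains \<Phi> :: "nat \<Rightarrow> nat \<Rightarrow> nat" where
    "recursive_on UNIV (\<lambda>z. \<Phi> (fst_of z) (snd_of z))"
    "\<And>q m. \<bar>rat_num (\<Phi> q m) - f (rat_num q)\<bar> \<le> (1 / 2) ^ m"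
proof -
  obtain p where p: "\<And>x g. cauchy_name g x \<Longrightarrow>
      \<exists>h. cauchy_name h (f x) \<and> (\<forall>n. run g p [n] = Some (h n))"
    using assms unfolding computable_real_fun_def by blast
  have "\<exists>h. cauchy_name h (f (rat_num q)) \<and> (\<forall>n. run (\<lambda>_. q) p [n] = Some (h n))" for q
    by (rule p) (simp add: cauchy_name_def rat_num_def)
  then obtain \<Phi> where \<Phi>: "\<And>q. cauchy_name (\<Phi> q) (f (rat_num q))"
    "\<And>q n. run (\<lambda>_. q) p [n] = Some (\<Phi> q n)"
    by metis
  have run: "run g (const_oracle 1 p) [n, q] = Some (\<Phi> q n)" for g n q
    using run_const_oracle[OF \<Phi>(2), of g] by simp
  have "recursive_on UNIV (\<lambda>z. \<Phi> (fst_of z) (snd_of z))"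
    by (rule recursive_binary_prog[where F = "\<lambda>n q. \<Phi> q n", OF run]) (intro recursive_intros)+
  moreover have "\<bar>rat_num (\<Phi> q m) - f (rat_num q)\<bar> \<le> (1 / 2) ^ m" for q m
    using \<Phi>(1)[of q] by (simp add: cauchy_name_def rat_num_def)
  ultimately show ?thesis using that by blast
qed

lemma rat_num_approx: "e > 0 \<Longrightarrow> \<exists>k. \<bar>rat_num k - x\<bar> < e"
  using rat_num_between[of "x - e" "x + e"] by (auto simp: abs_less_iff algebra_simps)

text \<open>An approximation to \<open>f x\<close> depends on finitely many terms of the name of
  \<open>x\<close>, and every \<open>x'\<close> close to \<open>x\<close> has a name with the same
  initial terms.\<close>

lemma computable_real_fun_continuous:
  assumes "computable_real_fun f"
  shows "continuous_on UNIV f"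
proof -
  obtain p where p: "\<And>x g. cauchy_name g x \<Longrightarrow>
      \<exists>h. cauchy_name h (f x) \<and> (\<forall>n. run g p [n] = Some (h n))"
    using assms unfolding computable_real_fun_def by blast
  have "\<exists>d>0. \<forall>x'. \<bar>x' - x\<bar> < d \<longrightarrow> \<bar>f x' - f x\<bar> < e" if "e > 0" for x e :: real
  proof -
    obtain n where n: "(1 / 2 :: real) ^ n < e / 2"
      using real_arch_pow_inv[of "e / 2" "1 / 2"] \<open>e > 0\<close> by auto
    \<comment> \<open>Half of the permitted error is kept in reserve, so that the first
      \<open>m\<close> terms also suit any \<open>x'\<close> within \<open>(1 / 2) ^ m / 2\<close>
      of \<open>x\<close>.\<close>
    have "\<exists>k. \<bar>rat_num k - x\<bar> < (1 / 2) ^ i / 2" for i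
      by (rule rat_num_approx) simp
    then obtain g where g: "\<And>i. \<bar>rat_num (g i) - x\<bar> < (1 / 2) ^ i / 2"
      by metis
    have "\<bar>rat_num (g i) - x\<bar> \<le> (1 / 2) ^ i" for i
      using g[of i] zero_less_power[of "1 / 2 :: real" i] by linarith
    then have "cauchy_name g x"
      by (simp add: cauchy_name_def rat_num_def)
    from p[OF this] obtain h where h: "cauchy_name h (f x)" "\<And>n. run g p [n] = Some (h n)"
      by blast
    obtain m where m: "\<And>g'. \<forall>i<m. g' i = g i \<Longrightarrow> run g' p [n] = Some (h n)"
      using run_use[OF h(2)] by blast
    have "\<bar>f x' - f x\<bar> < e" if x': "\<bar>x' - x\<bar> < (1 / 2) ^ m / 2" for x'
    proof -
      have "\<exists>k. \<bar>rat_num k - x'\<bar> < (1 / 2) ^ i" for i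
        by (rule rat_num_approx) simp
      then obtain a where a: "\<And>i. \<bar>rat_num (a i) - x'\<bar> < (1 / 2) ^ i"
        by metis
      define g' where "g' i = (if i < m then g i else a i)" for i
      have "\<bar>rat_num (g' i) - x'\<bar> \<le> (1 / 2) ^ i" for i
      proof (cases "i < m")
        case True
        then have "(1 / 2 :: real) ^ m \<le> (1 / 2) ^ i"
          by (intro power_decreasing) auto
        then show ?thesis
          using g[of i] x' True unfolding g'_def abs_less_iff abs_le_iff if_P[OF True] by linarith
      next
        case False
        then show ?thesis
          using a[of i] by (simp add: g'_def)
      qed
      then have "cauchy_name g' x'"
        by (simp add: cauchy_name_def rat_num_def)
      from p[OF this] obtain h' where h': "cauchy_name h' (f x')" "\<And>n. run g' p [n] = Some (h' n)"
        by blast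
      have "h' n = h n"
        using m[of g'] h'(2)[of n] by (simp add: g'_def)
      then have "\<bar>rat_num (h n) - f x'\<bar> \<le> (1 / 2) ^ n" "\<bar>rat_num (h n) - f x\<bar> \<le> (1 / 2) ^ n"
        using h'(1) h(1) by (auto simp: cauchy_name_def rat_num_def dest: spec[of _ n])
      then show ?thesis
        using n by linarith
    qed
    then show ?thesis
      by (intro exI[of _ "(1 / 2) ^ m / 2"]) simp
  qed
  then show ?thesis
    by (simp add: continuous_on_iff dist_real_def)
qed


section \<open>Finite lists of rational intervals\<close>

definition lo :: "nat \<Rightarrow> real" where "lo k = rat_num (fst_of k)"
definition hi :: "nat \<Rightarrow> real" where "hi k = rat_num (snd_of k)"

lemma rat_interval_eq: "rat_interval k = {lo k<..<hi k}"
  by (simp add: rat_interval_def lo_def hi_def rat_num_def fst_of_def snd_of_def split: prod.split)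

text \<open>Supplies a default output: an enumeration with nothing to list at some stage returns 0.
  Both endpoints decode to the same rational.\<close>

lemma rat_interval_0: "rat_interval 0 = {}"
proof -
  have "0 = prod_encode (0, 0)"
    by (simp add: prod_encode_def)
  then have "fst_of 0 = 0" "snd_of 0 = 0"
    by (metis fst_of_pair, metis snd_of_pair)
  then show ?thesis
    by (simp add: rat_interval_eq lo_def hi_def)
qed

lemma interval_code_between:
  assumes "a < b" "c < d"
  shows "\<exists>k. a < lo k \<and> lo k < b \<and> c < hi k \<and> hi k < d"
proof -
  obtain i j where "a < rat_num i" "rat_num i < b" "c < rat_num j" "rat_num j < d"
    using rat_num_between[OF assms(1)] rat_num_between[OF assms(2)] by blast
  then show ?thesis
    by (intro exI[of _ "prod_encode (i, j)"]) (simp add: lo_def hi_def)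
qed

lemma open_contains_rat_num:
  assumes "open V" "x \<in> V" shows "\<exists>q. rat_num q \<in> V"
proof -
  obtain e where "e > 0" "\<And>y. dist y x < e \<Longrightarrow> y \<in> V"
    using assms by (metis open_dist)
  then show ?thesis
    using rat_num_approx[of e x] by (auto simp: dist_real_def)
qed

lemma open_contains_rat_interval:
  assumes "open V" "x \<in> V" shows "\<exists>k. x \<in> rat_interval k \<and> {lo k..hi k} \<subseteq> V"
proof -
  obtain e where e: "e > 0" "\<And>y. dist y x < e \<Longrightarrow> y \<in> V"
    using assms by (metis open_dist)
  obtain k where "x - e < lo k" "lo k < x" "x < hi k" "hi k < x + e"
    using interval_code_between[of "x - e" x x "x + e"] e(1) by auto
  then show ?thesis
    using e(2) by (intro exI[of _ k]) (auto simp: rat_interval_eq dist_real_def)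
qed

text \<open>The first component of \<open>u\<close> is the length of the list; only that many
  entries are read below.\<close>

definition interval_at :: "nat \<Rightarrow> nat \<Rightarrow> nat" where
  "interval_at u i = entry (snd_of u) i"

definition list_open :: "nat \<Rightarrow> real set" where
  "list_open u = (\<Union>i<fst_of u. {lo (interval_at u i)<..<hi (interval_at u i)})"

definition list_closed :: "nat \<Rightarrow> real set" where
  "list_closed u = (\<Union>i<fst_of u. {lo (interval_at u i)..hi (interval_at u i)})"

text \<open>Without the ordering of the endpoints, reversed intervals would contribute negative
  lengths and could offset long ones.\<close>

definition small :: "nat \<Rightarrow> nat \<Rightarrow> bool" where
  "small u j \<longleftrightarrow> (\<forall>i<fst_of u. lo (interval_at u i) \<le> hi (interval_at u i)) \<and>
     (\<Sum>i<fst_of u. hi (interval_at u i) - lo (interval_at u i)) \<le> (1 / 2) ^ j"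

lemma interval_list_exists: "\<exists>u. fst_of u = n \<and> (\<forall>i<n. interval_at u i = k i)"
proof -
  obtain w where "\<forall>i<n. entry w i = k i"
    using entry_surj by blast
  then show ?thesis
    by (intro exI[of _ "prod_encode (n, w)"]) (simp add: interval_at_def)
qed

lemma open_list_open: "open (list_open u)"
  and compact_list_closed: "compact (list_closed u)"
  and list_open_subset_closed: "list_open u \<subseteq> list_closed u"
  by (auto simp: list_open_def list_closed_def less_imp_le)

lemma sets_list_closed [simp]: "list_closed u \<in> sets lebesgue"
  using compact_list_closed lmeasurable_compact by blast

lemma recursive_lo [recursive_intros]: "recursive_on G A \<Longrightarrow> recursive_real G (\<lambda>x. lo (A x))"
  and recursive_hi [recursive_intros]: "recursive_on G A \<Longrightarrow> recursive_real G (\<lambda>x. hi (A x))"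
  unfolding lo_def hi_def by (intro recursive_intros; assumption)+

lemma recursive_interval_at [recursive_intros]:
  "recursive_on G A \<Longrightarrow> recursive_on G B \<Longrightarrow> recursive_on G (\<lambda>x. interval_at (A x) (B x))"
  unfolding interval_at_def by (intro recursive_intros)

lemma decidable_small [recursive_intros]:
  assumes "recursive_on G U" "recursive_on G J" shows "decidable_on G (\<lambda>x. small (U x) (J x))"
proof -
  have "decidable_on G (\<lambda>z. small (fst_of z) (snd_of z))"
    unfolding small_def by (intro recursive_intros)
  then show ?thesis using assms by (rule recursive_binary)
qed

section \<open>Covers of null sets by short lists\<close>

lemma emeasure_small:
  assumes "small u j" shows "emeasure lebesgue (list_closed u) \<le> ennreal ((1 / 2) ^ j)"
proof -
  have "emeasure lebesgue (list_closed u) \<le>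
      (\<Sum>i<fst_of u. emeasure lebesgue {lo (interval_at u i)..hi (interval_at u i)})"
    unfolding list_closed_def by (intro emeasure_subadditive_finite) auto
  also have "\<dots> = (\<Sum>i<fst_of u. ennreal (hi (interval_at u i) - lo (interval_at u i)))"
    using assms by (intro sum.cong) (auto simp: small_def)
  also have "\<dots> = ennreal (\<Sum>i<fst_of u. hi (interval_at u i) - lo (interval_at u i))"
    using assms by (intro sum_ennreal) (auto simp: small_def)
  also have "\<dots> \<le> ennreal ((1 / 2) ^ j)"
    using assms by (intro ennreal_leI) (auto simp: small_def)
  finally show ?thesis .
qed

text \<open>Half of the permitted length goes to a cover by countably many nonoverlapping closed
  intervals, the other half to enlarging each of them to an open rational interval.\<close>

lemma null_set_interval_cover:
  assumes "N \<in> null_sets lebesgue" "N \<subseteq> {a..b}"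
  obtains k :: "nat \<Rightarrow> nat" where "N \<subseteq> (\<Union>i. rat_interval (k i))" "\<And>i. lo (k i) \<le> hi (k i)"
    "\<And>n. (\<Sum>i<n. hi (k i) - lo (k i)) \<le> (1 / 2) ^ j"
proof -
  define t :: real where "t = (1 / 2) ^ j"
  have "t > 0" by (simp add: t_def)
  have "N \<in> lmeasurable" "measure lebesgue N = 0"
    using assms(1) by (auto simp: negligible_iff_null_sets[symmetric] negligible_imp_measurable negligible_imp_measure0)
  moreover have "N \<subseteq> cbox a b" "t / 2 > 0"
    using assms(2) \<open>t > 0\<close> by auto
  ultimately obtain D where D: "countable D"
    "\<And>K. K \<in> D \<Longrightarrow> K \<subseteq> cbox a b \<and> K \<noteq> {} \<and> (\<exists>c d. K = cbox c d)"
    "pairwise (\<lambda>A B. interior A \<inter> interior B = {}) D"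
    "N \<subseteq> \<Union>D" "\<Union>D \<in> lmeasurable" "measure lebesgue (\<Union>D) \<le> t / 2"
    using measurable_outer_intervals_bounded[of N a b "t / 2"] by (metis add_0)
  have "\<exists>c d. K = {c..d} \<and> c \<le> d" if "K \<in> D" for K
    using D(2)[OF that] by force
  then obtain c d where cd: "\<And>K. K \<in> D \<Longrightarrow> K = {c K..d K} \<and> c K \<le> d K"
    by metis
  define ix where "ix = to_nat_on D"
  have inj: "inj_on ix D"
    unfolding ix_def using D(1) by (rule inj_on_to_nat_on)
  define el where "el i = inv_into D ix i" for i
  \<comment> \<open>Indices that enumerate no member of \<open>D\<close> receive the degenerate
    interval at 0, of length 0.\<close>
  define C where "C i = (if i \<in> ix ` D then c (el i) else 0)" for i
  define E where "E i = (if i \<in> ix ` D then d (el i) else 0)" for i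
  have el: "el (ix K) = K" if "K \<in> D" for K
    using inv_into_f_f[OF inj that] by (simp add: el_def)
  have CE: "C i \<le> E i" for i
    using cd by (auto simp: C_def E_def el)
  have sum_CE: "(\<Sum>i<n. E i - C i) \<le> t / 2" for n
  proof -
    define F where "F = {K \<in> D. ix K < n}"
    have "finite F"
      by (rule finite_imageD[of ix]) (auto simp: F_def intro: finite_subset[of _ "{..<n}"] inj_on_subset[OF inj])
    have F: "\<And>K. K \<in> F \<Longrightarrow> K \<in> lmeasurable" "F \<subseteq> D"
      using cd D(2) by (auto simp: F_def)
    have "(\<Sum>i<n. E i - C i) = (\<Sum>i\<in>ix ` F. E i - C i)"
      by (rule sum.mono_neutral_right) (auto simp: F_def C_def E_def)
    also have "\<dots> = (\<Sum>K\<in>F. d K - c K)"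
      by (subst sum.reindex) (auto simp: F_def C_def E_def el intro: inj_on_subset[OF inj])
    also have "\<dots> = (\<Sum>K\<in>F. measure lebesgue K)"
    proof (rule sum.cong[OF refl])
      fix K assume "K \<in> F"
      then have "K = {c K..d K}" "c K \<le> d K"
        using cd F(2) by auto
      then show "d K - c K = measure lebesgue K"
        by (metis measure_lborel_Icc measure_completion sets_lborel atLeastAtMost_borel)
    qed
    \<comment> \<open>The measures add up because two different members overlap in a convex set with
      empty interior, which is negligible.\<close>
    also have "\<dots> = measure lebesgue (\<Union>F)"
    proof (rule measure_negligible_finite_Union[symmetric, OF \<open>finite F\<close> F(1)])
      show "pairwise (\<lambda>S T. negligible (S \<inter> T)) F"
      proof (rule pairwiseI)
        fix S T assume "S \<in> F" "T \<in> F" "S \<noteq> T"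
        then have "interior (S \<inter> T) = {}"
          using D(3) F(2) by (auto simp: pairwise_def interior_Int)
        moreover have "convex (S \<inter> T)"
          using cd[of S] cd[of T] \<open>S \<in> F\<close> \<open>T \<in> F\<close> F(2) by (metis convex_Int convex_real_interval(5) subsetD)
        ultimately show "negligible (S \<inter> T)"
          by (simp add: negligible_convex_interior)
      qed
    qed
    also have "\<dots> \<le> measure lebesgue (\<Union>D)"
      using F \<open>finite F\<close> by (intro measure_mono_fmeasurable D(5)) (auto intro: fmeasurableD)
    finally show ?thesis using D(6) by simp
  qed
  \<comment> \<open>Each of the two endpoints moves by less than \<open>e i\<close>, and the sum of
    all \<open>2 * e i\<close> is \<open>t / 2\<close>.\<close>
  define e where "e i = t / 2 * (1 / 2) ^ (i + 2)" for i
  have "e i > 0" for i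
    using \<open>t > 0\<close> by (simp add: e_def)
  then have "\<exists>k. C i - e i < lo k \<and> lo k < C i \<and> E i < hi k \<and> hi k < E i + e i" for i
    using interval_code_between[of "C i - e i" "C i" "E i" "E i + e i"] by simp
  then obtain k where k: "\<And>i. C i - e i < lo (k i)" "\<And>i. lo (k i) < C i" "\<And>i. E i < hi (k i)"
    "\<And>i. hi (k i) < E i + e i"
    by metis
  show thesis
  proof (rule that)
    show "N \<subseteq> (\<Union>i. rat_interval (k i))"
    proof
      fix x assume "x \<in> N"
      then obtain K where K: "K \<in> D" "x \<in> K" using D(4) by blast
      then have "C (ix K) \<le> x" "x \<le> E (ix K)"
        using cd[OF K(1)] by (auto simp: C_def E_def el)
      then show "x \<in> (\<Union>i. rat_interval (k i))"
        using k(2,3)[of "ix K"] by (auto simp: rat_interval_eq intro!: exI[of _ "ix K"])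
    qed
    show "lo (k i) \<le> hi (k i)" for i
      using k(2,3)[of i] CE[of i] by simp
    fix n
    have "(\<Sum>i<n. hi (k i) - lo (k i)) \<le> (\<Sum>i<n. (E i - C i) + 2 * e i)"
    proof (rule sum_mono)
      fix i show "hi (k i) - lo (k i) \<le> (E i - C i) + 2 * e i"
        using k(1,4)[of i] by simp
    qed
    also have "\<dots> = (\<Sum>i<n. E i - C i) + t / 2 * (\<Sum>i<n. (1 / 2) ^ Suc i)"
      by (simp add: sum.distrib sum_distrib_left e_def)
    also have "(\<Sum>i<n. (1 / 2 :: real) ^ Suc i) = 1 - (1 / 2) ^ n"
      by (induction n) auto
    also have "t / 2 * (1 - (1 / 2) ^ n) \<le> t / 2 * 1"
      using \<open>t > 0\<close> by (intro mult_left_mono) auto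
    finally show "(\<Sum>i<n. hi (k i) - lo (k i)) \<le> (1 / 2) ^ j"
      using sum_CE[of n] by (simp add: t_def)
  qed
qed

lemma compact_null_set_small_cover:
  assumes "compact N" "N \<in> null_sets lebesgue"
  obtains u where "small u j" "N \<subseteq> list_open u"
proof -
  obtain a b where "N \<subseteq> {a..b}"
    using compact_imp_bounded[OF assms(1)] bounded_subset_cbox_symmetric[of N] by (metis cbox_interval)
  then obtain k :: "nat \<Rightarrow> nat" where k: "N \<subseteq> (\<Union>i. rat_interval (k i))" "\<And>i. lo (k i) \<le> hi (k i)"
    "\<And>n. (\<Sum>i<n. hi (k i) - lo (k i)) \<le> (1 / 2) ^ j"
    using null_set_interval_cover[OF assms(2)] by metis
  obtain I where I: "finite I" "N \<subseteq> (\<Union>i\<in>I. rat_interval (k i))"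
    using compactE_image[OF assms(1), of UNIV "\<lambda>i. rat_interval (k i)"] k(1)
    by (auto simp: rat_interval_eq)
  \<comment> \<open>The finite subcover is extended to an initial segment, for which the bound on
    the partial sums applies.\<close>
  obtain n where n: "I \<subseteq> {..<n}"
    using I(1) finite_nat_iff_bounded by blast
  obtain u where u: "fst_of u = n" "\<forall>i<n. interval_at u i = k i"
    using interval_list_exists by blast
  show thesis
  proof (rule that)
    show "small u j"
      using k(2,3) u by (simp add: small_def)
    show "N \<subseteq> list_open u"
      using I(2) n u by (auto simp: list_open_def rat_interval_eq subset_iff) blast
  qed
qed


section \<open>Compact null sets with large image\<close>

text \<open>Images of null sets need not be measurable, so outer measure is used for them;
  completeness leads back to null sets.\<close>

lemma outer_measure_zero_imp_null:
  assumes "outer_measure_of lebesgue (A :: real set) = 0" shows "A \<in> null_sets lebesgue"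
proof -
  obtain E where "E \<in> sets lebesgue" "A \<subseteq> E" "emeasure lebesgue E = 0"
    using outer_measure_of_attain[of A lebesgue] assms by auto
  then have "negligible E"
    by (auto simp: negligible_iff_null_sets)
  then have "negligible A"
    using \<open>A \<subseteq> E\<close> by (rule negligible_subset)
  then show ?thesis
    by (simp add: negligible_iff_null_sets)
qed

text \<open>Outer measure is continuous along increasing unions, even of nonmeasurable sets. Hence
  finitely many intervals of a cover already retain an image above the bound.\<close>

lemma null_set_piece_with_large_image:
  assumes "N \<in> null_sets lebesgue" "N \<subseteq> {a..b}" and large: "ennreal \<epsilon> < outer_measure_of lebesgue (f ` N)"
  obtains u where "small u j" "ennreal \<epsilon> < outer_measure_of lebesgue (f ` (N \<inter> list_open u))"
proof -
  obtain k :: "nat \<Rightarrow> nat" where k: "N \<subseteq> (\<Union>i. rat_interval (k i))" "\<And>i. lo (k i) \<le> hi (k i)"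
    "\<And>n. (\<Sum>i<n. hi (k i) - lo (k i)) \<le> (1 / 2) ^ j"
    using null_set_interval_cover[OF assms(1,2)] by metis
  define A where "A n = f ` (N \<inter> (\<Union>i<n. rat_interval (k i)))" for n
  have "incseq A"
    unfolding A_def incseq_def by fastforce
  then have "(SUP n. outer_measure_of lebesgue (A n)) = outer_measure_of lebesgue (\<Union>n. A n)"
    by (intro SUP_outer_measure_of_incseq) auto
  also have "(\<Union>n. A n) = f ` N"
    using k(1) unfolding A_def by (fastforce simp: subset_iff)
  finally obtain n where n: "ennreal \<epsilon> < outer_measure_of lebesgue (A n)"
    using large by (metis less_SUP_iff)
  obtain u where u: "fst_of u = n" "\<forall>i<n. interval_at u i = k i"
    using interval_list_exists by blast
  have "list_open u = (\<Union>i<n. rat_interval (k i))"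
    using u by (simp add: list_open_def rat_interval_eq)
  then have "A n = f ` (N \<inter> list_open u)"
    by (simp add: A_def)
  moreover have "small u j"
    using k(2,3) u by (simp add: small_def)
  ultimately show thesis
    using n that by metis
qed

text \<open>If all the bounded pieces of a null set had null images, so would their countable
  union.\<close>

lemma bounded_null_set_with_large_image:
  fixes f :: "real \<Rightarrow> real"
  assumes "\<not> Luzin_N f"
  obtains N a b e where "N \<in> null_sets lebesgue" "N \<subseteq> {a..b}"
    "ennreal ((1 / 2) ^ e) < outer_measure_of lebesgue (f ` N)"
proof -
  obtain N where N: "N \<in> null_sets lebesgue" "f ` N \<notin> null_sets lebesgue"
    using assms unfolding Luzin_N_def by blast
  have "\<exists>M::nat. x \<in> {- real M..real M}" for x
  proof -
    obtain M :: nat where "\<bar>x\<bar> \<le> real M"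
      using real_arch_simple by blast
    then show ?thesis by (intro exI[of _ M]) auto
  qed
  then have "N = (\<Union>M::nat. N \<inter> {- real M..real M})"
    by blast
  then have "f ` N = (\<Union>M::nat. f ` (N \<inter> {- real M..real M}))"
    by (metis image_UN)
  then obtain M :: nat where "f ` (N \<inter> {- real M..real M}) \<notin> null_sets lebesgue"
    using N(2) null_sets_UN[of "\<lambda>M::nat. f ` (N \<inter> {- real M..real M})" lebesgue] by metis
  then have pos: "0 < outer_measure_of lebesgue (f ` (N \<inter> {- real M..real M}))"
    using outer_measure_zero_imp_null not_gr_zero by blast
  have "\<exists>e. ennreal ((1 / 2) ^ e) < y" if "0 < y" for y
  proof (cases y)
    case (real r)
    then obtain e where "(1 / 2 :: real) ^ e < r"
      using real_arch_pow_inv[of r "1 / 2"] \<open>0 < y\<close> by auto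
    then show ?thesis
      using real by (auto simp: ennreal_less_iff)
  qed auto
  then obtain e where e: "ennreal ((1 / 2) ^ e) < outer_measure_of lebesgue (f ` (N \<inter> {- real M..real M}))"
    using pos by blast
  have "N \<inter> {- real M..real M} \<in> null_sets lebesgue"
    using N(1) by (rule null_set_Int2) simp
  then show thesis
    by (rule that[OF _ _ e]) auto
qed

text \<open>The complement is enumerated by all rational intervals that lie beside every interval of
  some list, a decidable relation between endpoints.\<close>

lemma computable_compact_list_closed:
  assumes L: "recursive_on O_oracle L" and small: "\<And>j. small (L j) j"
  shows "computable_compact Kleene_O (\<Inter>j. list_closed (L j))"
proof -
  define sep where "sep u k \<longleftrightarrow> (\<forall>i<fst_of u. hi k \<le> lo (interval_at u i) \<or> hi (interval_at u i) \<le> lo k)" for u k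
  have sep: "decidable_on O_oracle (\<lambda>z. sep (fst_of z) (snd_of z))"
    unfolding sep_def by (intro recursive_intros)
  define h where "h z = (if sep (L (fst_of z)) (snd_of z) then snd_of z else 0)" for z
  have "recursive_on O_oracle h"
    unfolding h_def by (intro recursive_intros recursive_binary[OF sep] recursive_comp[OF L])
  have "- (\<Inter>j. list_closed (L j)) = (\<Union>z. rat_interval (h z))"
  proof (intro equalityI subsetI)
    fix x assume "x \<in> - (\<Inter>j. list_closed (L j))"
    then obtain j where "x \<in> - list_closed (L j)" by blast
    moreover have "open (- list_closed (L j))"
      using compact_list_closed compact_imp_closed by blast
    ultimately obtain k where k: "x \<in> rat_interval k" "{lo k..hi k} \<subseteq> - list_closed (L j)"
      using open_contains_rat_interval by blast
    have "hi k \<le> lo (interval_at (L j) i) \<or> hi (interval_at (L j) i) \<le> lo k" if i: "i < fst_of (L j)" for i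
    proof (rule ccontr)
      assume *: "\<not> ?thesis"
      have "lo (interval_at (L j) i) \<le> hi (interval_at (L j) i)" "lo k < hi k"
        using small[of j] i k(1) by (auto simp: small_def rat_interval_eq)
      with * have "max (lo k) (lo (interval_at (L j) i)) \<in> {lo k..hi k}"
        "max (lo k) (lo (interval_at (L j) i)) \<in> {lo (interval_at (L j) i)..hi (interval_at (L j) i)}"
        by auto
      moreover from this(2) have "max (lo k) (lo (interval_at (L j) i)) \<in> list_closed (L j)"
        using i unfolding list_closed_def by blast
      moreover note k(2)
      ultimately show False by blast
    qed
    then have "h (prod_encode (j, k)) = k"
      by (simp add: h_def sep_def)
    with k(1) show "x \<in> (\<Union>z. rat_interval (h z))" by (metis UN_iff UNIV_I)
  next
    fix x assume "x \<in> (\<Union>z. rat_interval (h z))"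
    then obtain z where z: "x \<in> rat_interval (h z)" by blast
    then have "sep (L (fst_of z)) (snd_of z)" "x \<in> rat_interval (snd_of z)"
      by (auto simp: h_def rat_interval_0 split: if_splits)
    then have "x \<notin> list_closed (L (fst_of z))"
      by (fastforce simp: sep_def list_closed_def rat_interval_eq)
    then show "x \<in> - (\<Inter>j. list_closed (L j))" by blast
  qed
  moreover have "bounded (\<Inter>j. list_closed (L j))"
    by (rule bounded_subset[OF compact_imp_bounded[OF compact_list_closed[of "L 0"]]]) auto
  ultimately show ?thesis
    using \<open>recursive_on O_oracle h\<close> unfolding computable_compact_def effectively_closed_def computable_in_O_iff
    by blast
qed

lemma null_list_closed:
  assumes "\<And>j. small (L j) j" shows "(\<Inter>j. list_closed (L j)) \<in> null_sets lebesgue"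
proof -
  have le: "outer_measure_of lebesgue (\<Inter>j. list_closed (L j)) \<le> ennreal ((1 / 2) ^ j)" for j
  proof -
    have "outer_measure_of lebesgue (\<Inter>j. list_closed (L j)) \<le> outer_measure_of lebesgue (list_closed (L j))"
      by (rule outer_measure_of_mono) auto
    then show ?thesis
      using emeasure_small[OF assms[of j]] by simp
  qed
  have "(\<lambda>j. ennreal ((1 / 2) ^ j)) \<longlonglongrightarrow> ennreal 0"
    by (intro tendsto_ennrealI LIMSEQ_power_zero) auto
  then have "outer_measure_of lebesgue (\<Inter>j. list_closed (L j)) \<le> ennreal 0"
    by (rule LIMSEQ_le_const) (use le in auto)
  then show ?thesis
    by (intro outer_measure_zero_imp_null) simp
qed

definition in_list :: "nat \<Rightarrow> nat \<Rightarrow> bool" where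
  "in_list u q \<longleftrightarrow> (\<exists>i<fst_of u. lo (interval_at u i) < rat_num q \<and> rat_num q < hi (interval_at u i))"

text \<open>\<open>avoids u v m\<close> says that the interval of radius \<open>2\<^sup>-\<^sup>m\<close> around the approximation \<open>v\<close> of a
  value of \<open>f\<close> is disjoint from the open set coded by \<open>u\<close>.\<close>

definition avoids :: "nat \<Rightarrow> nat \<Rightarrow> nat \<Rightarrow> bool" where
  "avoids u v m \<longleftrightarrow> (\<forall>i<fst_of u. rat_num v + (1 / 2) ^ m \<le> lo (interval_at u i) \<or>
     hi (interval_at u i) \<le> rat_num v - (1 / 2) ^ m)"

lemma in_list_iff: "in_list u q \<longleftrightarrow> rat_num q \<in> list_open u"
  by (auto simp: in_list_def list_open_def)

lemma avoidsD: "avoids u v m \<Longrightarrow> \<bar>rat_num v - y\<bar> \<le> (1 / 2) ^ m \<Longrightarrow> y \<notin> list_open u"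
  unfolding avoids_def list_open_def by (fastforce simp: abs_le_iff)

text \<open>A point off the closed list has positive distance \<open>d\<close> from it, so a
  sufficiently precise approximation confirms that it avoids the open list.\<close>

lemma avoidsI:
  assumes v: "\<And>m. \<bar>rat_num (v m) - y\<bar> \<le> (1 / 2) ^ m" and y: "y \<notin> list_closed u" and u: "small u j"
  shows "\<exists>m. avoids u (v m) m"
proof -
  have "open (- list_closed u)"
    using compact_list_closed compact_imp_closed by blast
  then obtain d where d: "d > 0" "\<And>z. dist z y < d \<Longrightarrow> z \<notin> list_closed u"
    using y by (metis ComplD ComplI open_dist)
  \<comment> \<open>Approximation error and radius of the tested interval are each at most
    \<open>(1 / 2) ^ m\<close>, together less than \<open>d\<close>.\<close>
  obtain m where m: "(1 / 2 :: real) ^ m < d / 2"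
    using real_arch_pow_inv[of "d / 2" "1 / 2"] d(1) by auto
  have "rat_num (v m) + (1 / 2) ^ m \<le> lo (interval_at u i) \<or> hi (interval_at u i) \<le> rat_num (v m) - (1 / 2) ^ m"
    if i: "i < fst_of u" for i
  proof -
    have le: "lo (interval_at u i) \<le> hi (interval_at u i)"
      using u i by (simp add: small_def)
    have out: "\<not> (lo (interval_at u i) \<le> z \<and> z \<le> hi (interval_at u i))" if "\<bar>z - y\<bar> < d" for z
      using d(2)[of z] that i by (auto simp: list_closed_def dist_real_def)
    have "lo (interval_at u i) > y \<or> hi (interval_at u i) < y"
      using out[of y] d(1) by auto
    then have "lo (interval_at u i) \<ge> y + d \<or> hi (interval_at u i) \<le> y - d"
    proof -
      have "\<not> \<bar>lo (interval_at u i) - y\<bar> < d" "\<not> \<bar>hi (interval_at u i) - y\<bar> < d"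
        using out[of "lo (interval_at u i)"] out[of "hi (interval_at u i)"] le by auto
      with \<open>lo (interval_at u i) > y \<or> hi (interval_at u i) < y\<close> show ?thesis by linarith
    qed
    then show ?thesis
      using v[of m] m by (auto simp: abs_le_iff)
  qed
  then show ?thesis
    unfolding avoids_def by blast
qed

text \<open>Stage \<open>j\<close> of a solution consists of an interval list of total length at most \<open>2\<^sup>-\<^sup>j\<close> and, for the
  pair \<open>(n, u)\<close> coded by \<open>j\<close>, a rational point in the first \<open>n\<close> lists whose image avoids \<open>u\<close>,
  together with the precision that confirms this.\<close>

lemma luzin_failure_witness:
  assumes cont: "continuous_on UNIV f" and "\<not> Luzin_N f"
    and \<Phi>: "\<And>q m. \<bar>rat_num (\<Phi> q m) - f (rat_num q)\<bar> \<le> (1 / 2) ^ m"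
  obtains e L W where "\<And>j. small (L j) j"
    "\<And>n u. small u e \<Longrightarrow> (\<forall>i<n. in_list (L i) (fst_of (W n u))) \<and>
       avoids u (\<Phi> (fst_of (W n u)) (snd_of (W n u))) (snd_of (W n u))"
proof -
  obtain N a b e where N: "N \<in> null_sets lebesgue" "N \<subseteq> {a..b}"
    "ennreal ((1 / 2) ^ e) < outer_measure_of lebesgue (f ` N)"
    using bounded_null_set_with_large_image[OF assms(2)] by metis
  \<comment> \<open>The invariant of the construction: the part of \<open>N\<close> retained after
    each intersection with a new list still has an image above the bound.\<close>
  define large where "large X \<longleftrightarrow> X \<subseteq> N \<and> ennreal ((1 / 2) ^ e) < outer_measure_of lebesgue (f ` X)" for X
  have "\<exists>XL. \<forall>n. large (fst (XL n)) \<and> (small (snd (XL n)) n \<and> fst (XL (Suc n)) = fst (XL n) \<inter> list_open (snd (XL n)))"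
  proof -
    have step: "\<exists>u. small u j \<and> large (X \<inter> list_open u)" if "large X" for X j
    proof -
      have "X \<in> null_sets lebesgue"
        using N(1) that by (metis large_def negligible_iff_null_sets negligible_subset)
      moreover have "X \<subseteq> {a..b}"
        using N(2) that by (auto simp: large_def)
      ultimately obtain u where "small u j" "ennreal ((1 / 2) ^ e) < outer_measure_of lebesgue (f ` (X \<inter> list_open u))"
        using null_set_piece_with_large_image[of X a b _ f j] \<open>large X\<close> unfolding large_def by metis
      then show ?thesis
        using \<open>large X\<close> by (auto simp: large_def)
    qed
    define nxt where "nxt X j = (SOME u. small u j \<and> large (X \<inter> list_open u))" for X j
    have nxt: "small (nxt X j) j \<and> large (X \<inter> list_open (nxt X j))" if "large X" for X j
      unfolding nxt_def using step[OF that] by (rule someI_ex)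
    define X where "X = rec_nat N (\<lambda>j X. X \<inter> list_open (nxt X j))"
    have "large (X n)" for n
      by (induction n) (use N nxt in \<open>auto simp: X_def large_def[of N]\<close>)
    then show ?thesis
      using nxt by (intro exI[of _ "\<lambda>n. (X n, nxt (X n) n)"]) (simp add: X_def)
  qed
  then obtain XL where XL: "\<And>n. large (fst (XL n))" "\<And>n. small (snd (XL n)) n"
    "\<And>n. fst (XL (Suc n)) = fst (XL n) \<inter> list_open (snd (XL n))"
    by blast
  define L where "L n = snd (XL n)" for n
  define V where "V n = (\<Inter>i<n. list_open (L i))" for n
  have "open (V n)" for n
    unfolding V_def by (intro open_INT) (auto intro: open_list_open)
  have "V (Suc n) = V n \<inter> list_open (L n)" for n
    by (auto simp: V_def less_Suc_eq)
  then have XV: "fst (XL n) \<subseteq> V n" for n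
    by (induction n) (auto simp: V_def[of 0] XL(3) L_def)
  define witness where "witness n u w \<longleftrightarrow>
    (\<forall>i<n. in_list (L i) (fst_of w)) \<and> avoids u (\<Phi> (fst_of w) (snd_of w)) (snd_of w)" for n u w
  \<comment> \<open>A list of total length at most \<open>(1 / 2) ^ e\<close> is too short to
    contain the image of the retained set. Some point is therefore mapped outside, and by openness
    it can be moved to a rational one.\<close>
  have "\<exists>w. witness n u w" if u: "small u e" for n u
  proof -
    have "\<not> f ` fst (XL n) \<subseteq> list_closed u"
    proof
      assume "f ` fst (XL n) \<subseteq> list_closed u"
      then have "outer_measure_of lebesgue (f ` fst (XL n)) \<le> outer_measure_of lebesgue (list_closed u)"
        by (rule outer_measure_of_mono)
      also have "\<dots> = emeasure lebesgue (list_closed u)"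
        by (rule outer_measure_of_eq) (rule sets_list_closed)
      also note emeasure_small[OF u]
      finally show False
        using XL(1)[of n] unfolding large_def by (meson leD)
    qed
    then obtain x where x: "x \<in> V n" "f x \<in> - list_closed u"
      using XV[of n] by blast
    have "open (f -` (- list_closed u))"
      using compact_list_closed[of u] cont
      by (intro open_vimage) (auto simp: compact_imp_closed intro: open_Compl)
    with \<open>open (V n)\<close> have "open (V n \<inter> f -` (- list_closed u))" by blast
    then obtain q where q: "rat_num q \<in> V n" "f (rat_num q) \<notin> list_closed u"
      using open_contains_rat_num[of "V n \<inter> f -` (- list_closed u)" x] x by blast
    obtain m where "avoids u (\<Phi> q m) m"
      using avoidsI[of "\<Phi> q" "f (rat_num q)" u e] \<Phi> q(2) u by blast
    with q(1) show ?thesis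
      by (intro exI[of _ "prod_encode (q, m)"]) (auto simp: V_def in_list_iff witness_def)
  qed
  then have "witness n u (SOME w. witness n u w)" if "small u e" for n u
    using that by (blast intro: someI_ex)
  moreover have "\<And>j. small (L j) j"
    by (simp add: L_def XL(2))
  ultimately show thesis
    using that[of L e "\<lambda>n u. SOME w. witness n u w"] unfolding witness_def by blast
qed

text \<open>A compact null image would have a finite cover \<open>u\<close> of total length at most
  \<open>(1 / 2) ^ e\<close>. The witnesses for \<open>u\<close> show that the nested compact sets
  \<open>F n\<close> are nonempty; a common point is mapped outside \<open>u\<close>.\<close>

lemma image_not_null:
  fixes L :: "nat \<Rightarrow> nat"
  assumes cont: "continuous_on UNIV f"
    and \<Phi>: "\<And>q m. \<bar>rat_num (\<Phi> q m) - f (rat_num q)\<bar> \<le> (1 / 2) ^ m"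
    and W: "\<And>n u. small u e \<Longrightarrow> (\<forall>i<n. in_list (L i) (fst_of (W n u))) \<and>
       avoids u (\<Phi> (fst_of (W n u)) (snd_of (W n u))) (snd_of (W n u))"
  shows "f ` (\<Inter>j. list_closed (L j)) \<notin> null_sets lebesgue"
proof
  assume null: "f ` (\<Inter>j. list_closed (L j)) \<in> null_sets lebesgue"
  have "compact (\<Inter>j. list_closed (L j))"
    by (rule compact_Inter) (auto intro: compact_list_closed)
  then have "compact (f ` (\<Inter>j. list_closed (L j)))"
    using cont by (meson compact_continuous_image continuous_on_subset subset_UNIV)
  from compact_null_set_small_cover[OF this null]
  obtain u where u: "small u e" "f ` (\<Inter>j. list_closed (L j)) \<subseteq> list_open u"
    by metis
  define F where "F n = (\<Inter>i\<le>n. list_closed (L i)) \<inter> - (f -` list_open u)" for n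
  have "open (f -` list_open u)"
    using cont open_list_open by (intro open_vimage)
  moreover have "compact (\<Inter>i\<le>n. list_closed (L i))" for n
  proof (rule compact_Inter)
    have "n \<in> {..n}" by simp
    then show "(\<lambda>i. list_closed (L i)) ` {..n} \<noteq> {}" by blast
  qed (use compact_list_closed in auto)
  ultimately have "compact (F n)" for n
    unfolding F_def by (intro compact_Int_closed) auto
  moreover have "F n \<noteq> {}" for n
  proof -
    \<comment> \<open>The witness for \<open>Suc n\<close> lies in the lists 0 to \<open>n\<close>,
      as \<open>F n\<close> demands.\<close>
    define q where "q = fst_of (W (Suc n) u)"
    have "rat_num q \<in> (\<Inter>i\<le>n. list_closed (L i))"
      using W[OF u(1), of "Suc n"] list_open_subset_closed by (fastforce simp: q_def in_list_iff)
    moreover have "f (rat_num q) \<notin> list_open u"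
      using W[OF u(1), of "Suc n"] \<Phi> avoidsD unfolding q_def by blast
    ultimately show ?thesis
      unfolding F_def by blast
  qed
  moreover have "F n \<subseteq> F m" if "m \<le> n" for m n
    using that unfolding F_def by auto
  ultimately have "\<Inter>(range F) \<noteq> {}"
    by (rule compact_nest)
  then obtain x where "\<And>n. x \<in> F n" by blast
  then have "x \<in> list_closed (L n)" "f x \<notin> list_open u" for n
    unfolding F_def by auto
  then show False
    using u(2) by blast
qed

text \<open>The requirements on lists and witnesses are decidable stage by stage. An arbitrary
  solution thus gives a path, and the basis theorem turns it into a solution computable in the
  oracle.\<close>

lemma O_computable_luzin_counterexample:
  assumes f: "computable_real_fun f" and "\<not> Luzin_N f"
  obtains A where "computable_compact Kleene_O A" "A \<in> null_sets lebesgue" "f ` A \<notin> null_sets lebesgue"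
proof -
  obtain \<Phi> where rec\<Phi>: "recursive_on UNIV (\<lambda>z. \<Phi> (fst_of z) (snd_of z))" and
    \<Phi>: "\<And>q m. \<bar>rat_num (\<Phi> q m) - f (rat_num q)\<bar> \<le> (1 / 2) ^ m"
    using computable_real_fun_on_rationals[OF f] by metis
  note cont = computable_real_fun_continuous[OF f]
  obtain e L\<^sub>0 W\<^sub>0 where small\<^sub>0: "\<And>j. small (L\<^sub>0 j) j" and W\<^sub>0:
    "\<And>n u. small u e \<Longrightarrow> (\<forall>i<n. in_list (L\<^sub>0 i) (fst_of (W\<^sub>0 n u))) \<and>
       avoids u (\<Phi> (fst_of (W\<^sub>0 n u)) (snd_of (W\<^sub>0 n u))) (snd_of (W\<^sub>0 n u))"
    using luzin_failure_witness[OF cont assms(2) \<Phi>] by metis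
  \<comment> \<open>\<open>t i\<close> reads stage \<open>i\<close> from the stages 0 to
    \<open>j\<close>, stored last first. All lists with \<open>i < n\<close> are among them, since
    \<open>n \<le> j\<close>.\<close>
  define good where "good j s \<longleftrightarrow>
    (let t = \<lambda>i. entry s (j - i); n = fst_of j; u = snd_of j;
         q = fst_of (snd_of (t j)); m = snd_of (snd_of (t j))
     in small (fst_of (t j)) j \<and>
        (small u e \<longrightarrow> (\<forall>i<n. in_list (fst_of (t i)) q) \<and> avoids u (\<Phi> q m) m))" for j s
  have "decidable_on UNIV (\<lambda>z. in_list (fst_of z) (snd_of z))"
    unfolding in_list_def by (intro recursive_intros)
  note rec_in = recursive_binary[OF this]
  have "decidable_on UNIV (\<lambda>z. avoids (fst_of z) (fst_of (snd_of z)) (snd_of (snd_of z)))"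
    unfolding avoids_def by (intro recursive_intros)
  from recursive_comp[OF this]
  have rec_avoids: "decidable_on UNIV (\<lambda>x. avoids (A x) (B x) (C x))"
    if "recursive_on UNIV A" "recursive_on UNIV B" "recursive_on UNIV C" for A B C
    using recursive_pair[OF that(1) recursive_pair[OF that(2,3)]] by fastforce
  define P where "P n s \<longleftrightarrow> n = 0 \<or> good (n - 1) s" for n s
  have P: "decidable_on UNIV (\<lambda>z. P (fst_of z) (snd_of z))"
    unfolding P_def good_def Let_def by (intro recursive_intros rec_in rec_avoids recursive_binary[OF rec\<Phi>])
  have good: "good j (prefix_code \<alpha> (Suc j)) \<longleftrightarrow> small (fst_of (\<alpha> j)) j \<and>
      (small (snd_of j) e \<longrightarrow> (\<forall>i<fst_of j. in_list (fst_of (\<alpha> i)) (fst_of (snd_of (\<alpha> j)))) \<and>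
        avoids (snd_of j) (\<Phi> (fst_of (snd_of (\<alpha> j))) (snd_of (snd_of (\<alpha> j)))) (snd_of (snd_of (\<alpha> j))))" for j \<alpha>
  proof -
    have "entry (prefix_code \<alpha> (Suc j)) (j - i) = \<alpha> i" if "i \<le> j" for i
      using entry_prefix_code[of i "Suc j" \<alpha>] that by (simp del: prefix_code.simps)
    moreover have "i \<le> j" if "i < fst_of j" for i
      using that fst_of_le[of j] by simp
    moreover have "entry (prefix_code \<alpha> (Suc j)) 0 = \<alpha> j"
      by simp
    ultimately show ?thesis
      unfolding good_def Let_def by (simp del: prefix_code.simps)
  qed
  define \<beta> where "\<beta> j = prod_encode (L\<^sub>0 j, W\<^sub>0 (fst_of j) (snd_of j))" for j
  have "good j (prefix_code \<beta> (Suc j))" for j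
    using small\<^sub>0 W\<^sub>0 unfolding good by (simp add: \<beta>_def)
  then have "P n (prefix_code \<beta> n)" for n
    unfolding P_def by (cases n) (simp_all del: prefix_code.simps)
  from O_basis[OF P this] obtain \<alpha> where \<alpha>: "recursive_on O_oracle \<alpha>" "\<And>n. P n (prefix_code \<alpha> n)"
    by blast
  have "good j (prefix_code \<alpha> (Suc j))" for j
    using \<alpha>(2)[of "Suc j"] by (simp add: P_def del: prefix_code.simps)
  note good\<alpha> = this[unfolded good]
  define L where "L j = fst_of (\<alpha> j)" for j
  define W where "W n u = snd_of (\<alpha> (prod_encode (n, u)))" for n u
  have small: "small (L j) j" for j
    using good\<alpha>[of j] by (simp add: L_def)
  have W: "(\<forall>i<n. in_list (L i) (fst_of (W n u))) \<and>
       avoids u (\<Phi> (fst_of (W n u)) (snd_of (W n u))) (snd_of (W n u))" if "small u e" for n u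
    using good\<alpha>[of "prod_encode (n, u)"] that by (simp add: L_def W_def)
  have "recursive_on O_oracle L"
    unfolding L_def by (intro recursive_intros \<alpha>)
  show thesis
  proof (rule that)
    show "computable_compact Kleene_O (\<Inter>j. list_closed (L j))"
      using \<open>recursive_on O_oracle L\<close> small by (rule computable_compact_list_closed)
    show "(\<Inter>j. list_closed (L j)) \<in> null_sets lebesgue"
      using small by (rule null_list_closed)
    show "f ` (\<Inter>j. list_closed (L j)) \<notin> null_sets lebesgue"
      using cont \<Phi> W by (rule image_not_null)
  qed
qed


section \<open>Images of compact sets\<close>

lemma interval_list_of_finite:
  assumes "finite I" shows "\<exists>u. interval_at u ` {..<fst_of u} = I"
proof -
  obtain xs where xs: "set xs = I"
    using finite_list[OF assms] by blast
  obtain u where u: "fst_of u = length xs" "\<forall>i<length xs. interval_at u i = xs ! i"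
    using interval_list_exists by blast
  have "interval_at u ` {..<fst_of u} = set xs"
    using u by (force simp: set_conv_nth image_iff)
  then show ?thesis using xs by blast
qed

text \<open>An interval is listed if, for some finite list \<open>u\<close> covered by the
  enumerated complement of \<open>A\<close>, the function never takes a value in it on
  \<open>(-M, M)\<close> minus \<open>u\<close>. Finite search verifies the covering, and the oracle
  decides the universal condition.\<close>

lemma computable_compact_image:
  assumes f: "computable_real_fun f" and A: "computable_compact Kleene_O A"
  shows "computable_compact Kleene_O (f ` A)"
proof -
  obtain \<Phi> where rec\<Phi>: "recursive_on UNIV (\<lambda>z. \<Phi> (fst_of z) (snd_of z))" and
    \<Phi>: "\<And>q m. \<bar>rat_num (\<Phi> q m) - f (rat_num q)\<bar> \<le> (1 / 2) ^ m"
    using computable_real_fun_on_rationals[OF f] by metis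
  note cont = computable_real_fun_continuous[OF f]
  obtain h where h: "recursive_on O_oracle h" "- A = (\<Union>n. rat_interval (h n))"
    using A unfolding computable_compact_def effectively_closed_def computable_in_O_iff by blast
  have "compact A"
    using A by (rule computable_compact_imp_compact)
  then have "compact (f ` A)"
    using cont by (meson compact_continuous_image continuous_on_subset subset_UNIV)
  obtain M :: nat where M: "A \<subseteq> {- real M<..<real M}"
  proof -
    obtain B where "\<And>x. x \<in> A \<Longrightarrow> \<bar>x\<bar> \<le> B"
      using compact_imp_bounded[OF \<open>compact A\<close>] by (auto simp: bounded_iff)
    moreover obtain M :: nat where "B < real M"
      using reals_Archimedean2 by blast
    ultimately have "A \<subseteq> {- real M<..<real M}" by force
    then show ?thesis using that by blast
  qed
  define V where "V u = {- real M<..<real M} - list_closed u" for u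
  have "open (V u)" for u
    unfolding V_def using compact_list_closed[of u] by (intro open_Diff) (auto simp: compact_imp_closed)
  \<comment> \<open>\<open>R\<close> fails exactly when \<open>y\<close> codes a rational point of
    \<open>V u\<close> with an approximation that places its image inside the interval. By
    continuity, a violation at any real point yields one of this kind.\<close>
  define R where "R x y \<longleftrightarrow> \<not> ((- real M < rat_num (fst_of y) \<and> rat_num (fst_of y) < real M \<and>
      (\<forall>i<fst_of (fst_of x). \<not> (lo (interval_at (fst_of x) i) \<le> rat_num (fst_of y) \<and>
         rat_num (fst_of y) \<le> hi (interval_at (fst_of x) i)))) \<and>
      lo (snd_of x) < rat_num (\<Phi> (fst_of y) (snd_of y)) - (1 / 2) ^ snd_of y \<and>
      rat_num (\<Phi> (fst_of y) (snd_of y)) + (1 / 2) ^ snd_of y < hi (snd_of x))" for x y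
  have R: "R (prod_encode (u, k)) (prod_encode (q, m)) \<longleftrightarrow> \<not> (rat_num q \<in> V u \<and>
      lo k < rat_num (\<Phi> q m) - (1 / 2) ^ m \<and> rat_num (\<Phi> q m) + (1 / 2) ^ m < hi k)" for u k q m
    by (auto simp: R_def V_def list_closed_def)
  have "decidable_on UNIV (\<lambda>z. R (fst_of z) (snd_of z))"
    unfolding R_def by (intro recursive_intros recursive_binary[OF rec\<Phi>])
  from O_decides_universal[OF this]
  have dec: "decidable_on O_oracle (\<lambda>x. \<forall>y. R x y)" .
  have R_iff: "(\<forall>y. R (prod_encode (u, k)) y) \<longleftrightarrow> (\<forall>x\<in>V u. f x \<notin> rat_interval k)" for u k
  proof
    assume *: "\<forall>y. R (prod_encode (u, k)) y"
    show "\<forall>x\<in>V u. f x \<notin> rat_interval k"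
    proof (intro ballI notI)
      fix x assume x: "x \<in> V u" "f x \<in> rat_interval k"
      have "open (V u \<inter> f -` rat_interval k)"
        using \<open>open (V u)\<close> cont by (intro open_Int open_vimage) (simp_all add: rat_interval_eq)
      then obtain q where q: "rat_num q \<in> V u" "f (rat_num q) \<in> rat_interval k"
        using open_contains_rat_num[of _ x] x by blast
      define d where "d = min (f (rat_num q) - lo k) (hi k - f (rat_num q))"
      have "d > 0"
        using q(2) by (simp add: d_def rat_interval_eq)
      then obtain m where "(1 / 2 :: real) ^ m < d / 2"
        using real_arch_pow_inv[of "d / 2" "1 / 2"] by auto
      then have "lo k < rat_num (\<Phi> q m) - (1 / 2) ^ m" "rat_num (\<Phi> q m) + (1 / 2) ^ m < hi k"
        using \<Phi>[of q m] by (auto simp: d_def abs_le_iff)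
      then show False
        using q(1) * R by blast
    qed
  next
    assume *: "\<forall>x\<in>V u. f x \<notin> rat_interval k"
    have "R (prod_encode (u, k)) (prod_encode (q, m))" for q m
      using * \<Phi>[of q m] by (fastforce simp: R rat_interval_eq abs_le_iff)
    then show "\<forall>y. R (prod_encode (u, k)) y"
      by (metis pair_fst_snd)
  qed
  \<comment> \<open>The strict inequalities put the closed intervals of \<open>u\<close> into the
    complement of \<open>A\<close>; \<open>N\<close> bounds the search through its
    enumeration.\<close>
  define inside where "inside u N \<longleftrightarrow> (\<forall>i<fst_of u. \<exists>n<N. lo (h n) < lo (interval_at u i) \<and>
      hi (interval_at u i) < hi (h n))" for u N
  have inside: "decidable_on O_oracle (\<lambda>z. inside (fst_of z) (snd_of z))"
    unfolding inside_def by (intro recursive_intros recursive_comp[OF h(1)])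
  define g where "g z = (if inside (snd_of (snd_of z)) (fst_of (snd_of z)) \<and>
      (\<forall>y. R (prod_encode (snd_of (snd_of z), fst_of z)) y) then fst_of z else 0)" for z
  have "recursive_on O_oracle g"
    unfolding g_def by (intro recursive_intros recursive_binary[OF inside] recursive_comp[OF dec])
  moreover have "- (f ` A) = (\<Union>z. rat_interval (g z))"
  proof (intro equalityI subsetI)
    fix y assume y: "y \<in> - (f ` A)"
    have "open (- (f ` A))"
      using \<open>compact (f ` A)\<close> compact_imp_closed by blast
    then obtain k where k: "y \<in> rat_interval k" "{lo k..hi k} \<subseteq> - (f ` A)"
      using open_contains_rat_interval y by blast
    \<comment> \<open>These are the points that \<open>u\<close> has to remove. They form a compact
      set disjoint from \<open>A\<close>, because the closed interval misses the image, so finitely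
      many intervals of the complement suffice.\<close>
    define C where "C = {- real M..real M} \<inter> f -` {lo k..hi k}"
    have "compact C"
      unfolding C_def using cont by (intro compact_Int_closed closed_vimage) auto
    define Q where "Q = {k'. \<exists>n. lo (h n) < lo k' \<and> hi k' < hi (h n)}"
    have "C \<subseteq> (\<Union>k'\<in>Q. rat_interval k')"
    proof
      fix x assume "x \<in> C"
      then have "x \<in> - A"
        using k(2) by (auto simp: C_def)
      then obtain n where "x \<in> rat_interval (h n)"
        using h(2) by blast
      then obtain k' where k': "x \<in> rat_interval k'" "{lo k'..hi k'} \<subseteq> rat_interval (h n)"
        using open_contains_rat_interval[of "rat_interval (h n)" x] by (auto simp: rat_interval_eq)
      then have "lo k' \<in> rat_interval (h n)" "hi k' \<in> rat_interval (h n)"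
        by (auto simp: rat_interval_eq subset_iff)
      then have "k' \<in> Q"
        by (auto simp: Q_def rat_interval_eq intro!: exI[of _ n])
      with k'(1) show "x \<in> (\<Union>k'\<in>Q. rat_interval k')" by blast
    qed
    then obtain I where I: "I \<subseteq> Q" "finite I" "C \<subseteq> (\<Union>k'\<in>I. rat_interval k')"
      using compactE_image[OF \<open>compact C\<close>, of Q rat_interval] by (auto simp: rat_interval_eq)
    obtain u where u: "interval_at u ` {..<fst_of u} = I"
      using interval_list_of_finite[OF I(2)] by blast
    have "\<forall>k'\<in>I. \<exists>n. lo (h n) < lo k' \<and> hi k' < hi (h n)"
      using I(1) by (auto simp: Q_def)
    then obtain n where n: "\<forall>k'\<in>I. lo (h (n k')) < lo k' \<and> hi k' < hi (h (n k'))"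
      by (rule bchoice[THEN exE])
    obtain N where N: "n ` I \<subseteq> {..<N}"
      using I(2) finite_nat_iff_bounded by blast
    have "inside u N"
      unfolding inside_def
    proof (intro allI impI)
      fix i assume "i < fst_of u"
      then have "interval_at u i \<in> I" using u by blast
      then show "\<exists>n<N. lo (h n) < lo (interval_at u i) \<and> hi (interval_at u i) < hi (h n)"
        using n N by blast
    qed
    moreover have "f x \<notin> rat_interval k" if x: "x \<in> V u" for x
    proof
      assume "f x \<in> rat_interval k"
      then have "x \<in> C"
        using x by (auto simp: C_def V_def rat_interval_eq)
      then obtain i where "i < fst_of u" "x \<in> rat_interval (interval_at u i)"
        using I(3) unfolding u[symmetric] by blast
      then have "x \<in> list_closed u"
        using list_open_subset_closed[of u] unfolding list_open_def rat_interval_eq by blast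
      with x show False by (simp add: V_def)
    qed
    ultimately have "g (prod_encode (k, prod_encode (N, u))) = k"
      by (simp add: g_def R_iff)
    with k(1) show "y \<in> (\<Union>z. rat_interval (g z))"
      by (metis UN_iff UNIV_I)
  next
    fix y assume "y \<in> (\<Union>z. rat_interval (g z))"
    then obtain z where z: "y \<in> rat_interval (g z)" by blast
    define u where "u = snd_of (snd_of z)"
    have g: "inside u (fst_of (snd_of z))" "\<And>x. x \<in> V u \<Longrightarrow> f x \<notin> rat_interval (fst_of z)" "g z = fst_of z"
      using z by (auto simp: g_def u_def R_iff rat_interval_0 split: if_splits)
    show "y \<in> - (f ` A)"
    proof
      assume "y \<in> f ` A"
      then obtain x where x: "x \<in> A" "y = f x" by blast
      have "x \<notin> list_closed u"
      proof
        assume "x \<in> list_closed u"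
        then obtain i where i: "i < fst_of u" "lo (interval_at u i) \<le> x" "x \<le> hi (interval_at u i)"
          by (auto simp: list_closed_def)
        then obtain n where "lo (h n) < x" "x < hi (h n)"
          using g(1) unfolding inside_def by (meson le_less_trans less_le_trans)
        then have "x \<in> - A"
          unfolding h(2) by (auto simp: rat_interval_eq)
        with x(1) show False by blast
      qed
      then have "x \<in> V u"
        using x(1) M by (auto simp: V_def)
      then show False
        using g(2,3) z x(2) by auto
    qed
  qed
  ultimately show ?thesis
    using \<open>compact (f ` A)\<close> unfolding computable_compact_def effectively_closed_def computable_in_O_iff
    by (blast intro: compact_imp_bounded)
qed

section \<open>Countability, and the null set of nonrandom reals\<close>

lemma countable_computable_compact: "countable {A. computable_compact Z A}"
proof -
  \<comment> \<open>A set is recovered from a program that enumerates its complement, and there are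
    countably many programs.\<close>
  define S where "S p = - (\<Union>n. rat_interval (the (run (\<lambda>k. of_bool (k \<in> Z)) p [n])))" for p
  have "{A. computable_compact Z A} \<subseteq> range S"
  proof
    fix A assume "A \<in> {A. computable_compact Z A}"
    then obtain h p where "- A = (\<Union>n. rat_interval (h n))"
      "\<And>n. run (\<lambda>k. of_bool (k \<in> Z)) p [n] = Some (h n)"
      unfolding computable_compact_def effectively_closed_def computable_in_def by blast
    then have "A = S p"
      by (simp add: S_def) blast
    then show "A \<in> range S" by blast
  qed
  moreover have "countable (UNIV :: prog set)"
    using inj_prog_code by (rule countableI)
  ultimately show ?thesis
    by (meson countable_image countable_subset)
qed

lemma null_set_not_Kurtz_random: "{x. \<not> Kurtz_random Z x} \<in> null_sets lebesgue"
proof -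
  define \<A> where "\<A> = {A. computable_compact Z A \<and> A \<in> null_sets lebesgue}"
  have "countable \<A>"
    by (rule countable_subset[OF _ countable_computable_compact[of Z]]) (auto simp: \<A>_def)
  then have "(\<Union>A\<in>\<A>. A) \<in> null_sets lebesgue"
    by (rule null_sets_UN') (simp add: \<A>_def)
  moreover have "{x. \<not> Kurtz_random Z x} = (\<Union>A\<in>\<A>. A)"
    unfolding Kurtz_random_def \<A>_def by blast
  ultimately show ?thesis by simp
qed

theorem theorem3p18:
  fixes f :: "real \<Rightarrow> real"
  assumes "computable_real_fun f"
  shows "(Luzin_N f \<longleftrightarrow>
            (\<forall>A. computable_compact Kleene_O A \<and> A \<in> null_sets lebesgue \<longrightarrow>
                 f ` A \<in> null_sets lebesgue)) \<and>
         (Luzin_N f \<longleftrightarrow> reflects_Kurtz_randomness Kleene_O f)"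
proof -
  let ?null = "\<forall>A. computable_compact Kleene_O A \<and> A \<in> null_sets lebesgue \<longrightarrow>
                 f ` A \<in> null_sets lebesgue"
  have "Luzin_N f \<Longrightarrow> ?null"
    unfolding Luzin_N_def by blast
  moreover have "?null \<Longrightarrow> Luzin_N f"
    using O_computable_luzin_counterexample[OF assms] by metis
  moreover have "reflects_Kurtz_randomness Kleene_O f" if "Luzin_N f"
    unfolding reflects_Kurtz_randomness_def
  proof (intro allI impI, rule ccontr)
    fix x assume random: "Kurtz_random Kleene_O (f x)" and "\<not> Kurtz_random Kleene_O x"
    then obtain A where "computable_compact Kleene_O A" "A \<in> null_sets lebesgue" "x \<in> A"
      unfolding Kurtz_random_def by blast
    \<comment> \<open>The image of the set that captures \<open>x\<close> captures
      \<open>f x\<close>.\<close>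
    then have "computable_compact Kleene_O (f ` A)" "f ` A \<in> null_sets lebesgue" "f x \<in> f ` A"
      using computable_compact_image[OF assms] that unfolding Luzin_N_def by auto
    with random show False
      unfolding Kurtz_random_def by blast
  qed
  moreover have ?null if reflects: "reflects_Kurtz_randomness Kleene_O f"
  proof (intro allI impI, elim conjE)
    fix A assume "computable_compact Kleene_O A" "A \<in> null_sets lebesgue"
    \<comment> \<open>By contraposition of reflection, points of \<open>A\<close> have nonrandom
      images, and the nonrandom reals form a null set.\<close>
    then have "f ` A \<subseteq> {y. \<not> Kurtz_random Kleene_O y}"
      using reflects unfolding reflects_Kurtz_randomness_def Kurtz_random_def[of _ "_ :: real"] by blast
    then show "f ` A \<in> null_sets lebesgue"
      using null_set_not_Kurtz_random negligible_subset unfolding negligible_iff_null_sets[symmetric]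
      by blast
  qed
  ultimately show ?thesis by blast
qed

end
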